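(* Let $X$ be a centered, nondegenerate, infinitely divisible real random variable with finite variance $V>0$ and Lévy measure $\nu$ satisfying $\int_{|x|>1}|x|^3\,\nu(dx)<\infty$, let $\kappa_3$ be the third cumulant of $X$, and let $m_1=\mathbb{E}R=\kappa_3/(3V)$. Assume $\tau>0$. Then $$\lim_{t\downarrow0}\Psi_1(t)=m_1,\qquad\text{while}\qquad \lim_{t\downarrow0}\Psi_\theta(t)=-\infty\quad\text{for every }\theta>1 .$$ Hence the local obstruction $c_*(V)\ge\max\{0,\kappa_3/(3V)\}$ at $v=V$ has no analogue for $v>V$: for every $v>V$, with $\theta=v/V$, at least one of the following holds: the supremum $\sup_{t>0}\Psi_\theta(t)$ is attained at some $t\in(0,\infty)$; or $\tau<\infty$ and $c_*(v)=\sup_{t>0}\Psi_\theta(t)=1/\tau$; or $\sup_{t>0}\Psi_\theta(t)\le0$, in which case $c_*(v)=0$.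
   Context: Standing setting: $X$ is a centered, nondegenerate, infinitely divisible real random variable with variance $0<V=\mathrm{Var}(X)<\infty$, Gaussian variance $a\ge0$ and Lévy measure $\nu$ on $\mathbb{R}\setminus\{0\}$. For all real $t$, $K_X(t)=\log\mathbb{E}e^{tX}=\frac{at^2}{2}+\int_{\mathbb{R}\setminus\{0\}}(e^{tx}-1-tx)\,\nu(dx)\in[0,\infty]$, and $V=a+\int x^2\,\nu(dx)$. $\tau=\sup\{t>0:K_X(t)<\infty\}\in[0,\infty]$ (with $\sup\emptyset=0$). Let $H_X(dx)=a\delta_0(dx)+x^2\nu(dx)$ (total mass $V$), let $Z$ have law $H_X/V$, let $B\sim\mathrm{Beta}(1,2)$ (density $2(1-b)$ on $(0,1)$) be independent of $Z$, and put $R=BZ$, $M_R(t)=\mathbb{E}e^{tR}\in(0,\infty]$. For $\theta>0$ and $t>0$, $\Psi_\theta(t)=\frac1t\bigl(1-\frac{\theta}{M_R(t)}\bigr)$. Conventions: $1/0=\infty$, $1/\infty=0$, $\theta/\infty=0$. A pair $(v,c)\in(0,\infty)\times[0,\infty)$ is feasible for $X$ if $K_X(t)\le \frac{vt^2}{2(1-ct)}$ for every $0\le t<1/c$ (for $c=0$: for all $t\ge0$). $c_*(v)=\inf\{c\ge0:(v,c)\text{ is feasible}\}\in[0,\infty]$, with $\inf\emptyset=\infty$. *)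

theory Defs
  imports "HOL-Probability.Probability"
begin

(* The law of a sum of n i.i.d. variables with law \<rho>, for every n \<ge> 1. *)
definition infinitely_divisible :: "real measure \<Rightarrow> bool" where
  "infinitely_divisible \<mu> \<longleftrightarrow> real_distribution \<mu> \<and>
     (\<forall>n::nat. n \<ge> 1 \<longrightarrow> (\<exists>\<rho>. real_distribution \<rho> \<and>
        distr (Pi\<^sub>M {..<n} (\<lambda>_. \<rho>)) borel (\<lambda>x. \<Sum>i<n. x i) = \<mu>))"

(* Measures on the punctured line are encoded as Borel measures on the line without mass at 0. *)
definition levy_measure :: "real measure \<Rightarrow> bool" where
  "levy_measure \<nu> \<longleftrightarrow> sets \<nu> = sets borel \<and> emeasure \<nu> {0} = 0 \<and>
     (\<integral>\<^sup>+x. ennreal (min 1 (x\<^sup>2)) \<partial>\<nu>) < \<infinity>"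

(* Levy-Khintchine representation with the usual truncation at 1; the drift d is not recorded. *)
definition has_levy_characteristics :: "real measure \<Rightarrow> real \<Rightarrow> real measure \<Rightarrow> bool" where
  "has_levy_characteristics \<mu> a \<nu> \<longleftrightarrow> a \<ge> 0 \<and> levy_measure \<nu> \<and>
     (\<exists>d::real. \<forall>u. char \<mu> u =
        exp (\<i> * of_real (d * u) - of_real (a * u\<^sup>2 / 2)
             + (LINT x|\<nu>. exp (\<i> * of_real (u * x)) - 1
                 - \<i> * of_real (u * x * indicator {-1..1} x))))"

(* n-th cumulant: i^(-n) times the n-th derivative at 0 of the logarithm of the characteristic
   function. Near 0 the characteristic function is close to 1, so the principal branch Ln is
   the right one; meaningful when the n-th absolute moment is finite. *)
definition cumulant :: "nat \<Rightarrow> real measure \<Rightarrow> real" where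
  "cumulant n \<mu> =
     Re ((((\<lambda>f u. vector_derivative f (at u)) ^^ n) (\<lambda>u. Ln (char \<mu> u)) 0) / \<i> ^ n)"

definition mgf :: "'a measure \<Rightarrow> ('a \<Rightarrow> real) \<Rightarrow> real \<Rightarrow> ennreal" where
  "mgf M X t = (\<integral>\<^sup>+\<omega>. ennreal (exp (t * X \<omega>)) \<partial>M)"

definition cgf :: "'a measure \<Rightarrow> ('a \<Rightarrow> real) \<Rightarrow> real \<Rightarrow> ereal" where
  "cgf M X t = (if mgf M X t = \<infinity> then \<infinity> else ereal (ln (enn2real (mgf M X t))))"

(* The inserted 0 realises the convention that the supremum of the empty set is 0. *)
definition tau :: "'a measure \<Rightarrow> ('a \<Rightarrow> real) \<Rightarrow> ereal" where
  "tau M X = Sup (insert 0 (ereal ` {t. t > 0 \<and> cgf M X t < \<infinity>}))"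

(* a * \<delta>_0 + x^2 \<nu>(dx) *)
definition H_meas :: "real \<Rightarrow> real measure \<Rightarrow> real measure" where
  "H_meas a \<nu> = measure_of UNIV (sets borel)
     (\<lambda>A. ennreal a * indicator A 0 + (\<integral>\<^sup>+x\<in>A. ennreal (x\<^sup>2) \<partial>\<nu>))"

lemma sets_H_meas [simp]: "sets (H_meas a \<nu>) = sets borel"
  unfolding H_meas_def by (metis sets.sigma_sets_eq sets_measure_of space_borel subset_UNIV
      Pow_UNIV)

lemma emeasure_H_meas:
  assumes "sets \<nu> = sets borel" "A \<in> sets borel"
  shows "emeasure (H_meas a \<nu>) A =
    ennreal a * indicator A 0 + (\<integral>\<^sup>+x\<in>A. ennreal (x\<^sup>2) \<partial>\<nu>)"
proof (rule emeasure_measure_of[OF H_meas_def])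
  have [measurable_cong]: "sets \<nu> = sets borel" by fact
  have D: "(\<integral>\<^sup>+x\<in>A. ennreal (x\<^sup>2) \<partial>\<nu>) = emeasure (density \<nu> (\<lambda>x. ennreal (x\<^sup>2))) A"
    if "A \<in> sets borel" for A
    using that by (subst emeasure_density) (auto simp: assms(1))
  have I: "(indicator A 0 :: ennreal) = emeasure (return borel (0::real)) A"
    if "A \<in> sets borel" for A
    using that by simp
  show "countably_additive (sets (H_meas a \<nu>))
     (\<lambda>A. ennreal a * indicator A 0 + (\<integral>\<^sup>+x\<in>A. ennreal (x\<^sup>2) \<partial>\<nu>))"
  proof (rule countably_additiveI, goal_cases)
    case (1 F)
    then have F: "range F \<subseteq> sets borel" "\<And>i. F i \<in> sets borel" "(\<Union>i. F i) \<in> sets borel"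
      by auto
    show ?case
      using F 1(2)
      by (simp only: D I suminf_add[OF summableI summableI, symmetric] ennreal_suminf_cmult)
         (simp add: suminf_emeasure suminf_indicator assms(1))
  qed
qed (auto simp: positive_def assms)

definition Z_law :: "real \<Rightarrow> real measure \<Rightarrow> real \<Rightarrow> real measure" where
  "Z_law a \<nu> V = scale_measure (ennreal (1 / V)) (H_meas a \<nu>)"

definition beta_1_2 :: "real measure" where
  "beta_1_2 = density lborel (\<lambda>b. ennreal (2 * (1 - b)) * indicator {0<..<1} b)"

(* The law of R = B * Z with B and Z independent. *)
definition R_law :: "real \<Rightarrow> real measure \<Rightarrow> real \<Rightarrow> real measure" where
  "R_law a \<nu> V = distr (beta_1_2 \<Otimes>\<^sub>M Z_law a \<nu> V) borel (\<lambda>(b, z). b * z)"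

(* Division in ennreal yields \<theta>/\<infinity> = 0. *)
definition Psi :: "real \<Rightarrow> real measure \<Rightarrow> real \<Rightarrow> real \<Rightarrow> real \<Rightarrow> real" where
  "Psi a \<nu> V \<theta> t = 1 / t * (1 - enn2real (ennreal \<theta> / mgf (R_law a \<nu> V) (\<lambda>r. r) t))"

definition feasible :: "'a measure \<Rightarrow> ('a \<Rightarrow> real) \<Rightarrow> real \<Rightarrow> real \<Rightarrow> bool" where
  "feasible M X v c \<longleftrightarrow> v > 0 \<and> c \<ge> 0 \<and>
     (\<forall>t\<ge>0. (c = 0 \<or> t < 1 / c) \<longrightarrow> cgf M X t \<le> ereal (v * t\<^sup>2 / (2 * (1 - c * t))))"

definition c_star :: "'a measure \<Rightarrow> ('a \<Rightarrow> real) \<Rightarrow> real \<Rightarrow> ereal" where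
  "c_star M X v = Inf (ereal ` {c. feasible M X v c})"

end

theory Submission
  imports Defs
begin

text \<open>
  The whole statement rests on the representation \<open>K(t) = (V t\<^sup>2 / 2) M\<^sub>R(t)\<close> for all \<open>t > 0\<close>, as an identity in
  \<open>[0,\<infinity>]\<close> (\<open>cgf_eq_mgf_R\<close>). Given this, the condition \<open>K(t) \<le> v t\<^sup>2 / (2 (1 - c t))\<close> at a single \<open>t\<close> is equivalent to
  \<open>\<Psi>\<^sub>\<theta>(t) \<le> c\<close> with \<open>\<theta> = v / V\<close>, so \<open>c\<^sub>*(v) = max 0 (sup \<Psi>\<^sub>\<theta>)\<close> (\<open>c_star_eq\<close>). The limits at the origin follow from
  \<open>M\<^sub>R(t) = 1 + m\<^sub>1 t + o(t)\<close>. For \<open>\<theta> > 1\<close> the function \<open>\<Psi>\<^sub>\<theta>\<close> tends to \<open>-\<infinity>\<close> at the origin, is continuous on \<open>(0,\<tau>)\<close>, is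
  bounded by \<open>1/t\<close> everywhere and equals \<open>1/t\<close> beyond \<open>\<tau>\<close>. A supremum that is positive and exceeds \<open>1/\<tau>\<close> is thus
  attained on a compact subinterval of \<open>(0,\<tau>)\<close> (\<open>Psi_sup_attained\<close>), and the only other positive value is \<open>1/\<tau>\<close>.

  The Levy-Khintchine formula is a statement about the characteristic function \<open>\<phi>\<close>, and the representation must be
  transferred from the imaginary to the real axis without assuming that any exponential moment exists. The equation
  \<open>\<phi>' = \<phi> \<psi>'\<close> for \<open>\<phi> = exp \<psi>\<close> says that the zero-bias transform of the law \<open>\<mu>\<close> of \<open>X\<close> is the convolution of \<open>\<mu>\<close> with the
  law of \<open>U Z\<close>, \<open>U\<close> uniform on \<open>[0,1]\<close> and independent of \<open>Z\<close> (\<open>zero_bias_convolution\<close>). By uniqueness of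
  characteristic functions this is an equality of probability measures, which may be tested against nonnegative
  functions. The function \<open>e\<^sup>s\<^sup>y\<close> gives \<open>m' = m G'\<close> for \<open>m(s) = E e\<^sup>s\<^sup>X\<close> and \<open>G(s) = (V s\<^sup>2 / 2) M\<^sub>R(s)\<close>, hence \<open>log m = G\<close>
  wherever both are finite, and finiteness of \<open>G\<close> where \<open>m\<close> is finite. Conversely, a truncated exponential gives
  a Gronwall inequality for \<open>E exp (s min(X, n))\<close> uniformly in \<open>n\<close>, which bounds \<open>m(t)\<close> as soon as \<open>G(t)\<close> is finite.
\<close>

section \<open>Integrals depending on a parameter\<close>

lemma tendsto_integral_param:
  fixes f :: "real \<Rightarrow> 'b \<Rightarrow> 'c::{banach, second_countable_topology}"
  assumes meas: "\<And>s. s \<in> S \<Longrightarrow> f s \<in> borel_measurable N" "l \<in> borel_measurable N"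
    and lim: "\<And>x. ((\<lambda>s. f s x) \<longlongrightarrow> l x) (at u within S)"
    and bound: "\<And>s x. s \<in> S \<Longrightarrow> s \<noteq> u \<Longrightarrow> norm (f s x) \<le> g x"
    and g: "integrable N g"
  shows "((\<lambda>s. LINT x|N. f s x) \<longlongrightarrow> (LINT x|N. l x)) (at u within S)"
  unfolding tendsto_at_iff_sequentially comp_def
proof (intro allI impI)
  fix X :: "nat \<Rightarrow> real" assume X: "\<forall>i. X i \<in> S - {u}" "X \<longlonglongrightarrow> u"
  show "(\<lambda>i. LINT x|N. f (X i) x) \<longlonglongrightarrow> (LINT x|N. l x)"
  proof (rule integral_dominated_convergence[where w=g])
    show "AE x in N. (\<lambda>i. f (X i) x) \<longlonglongrightarrow> l x"
      using lim X unfolding tendsto_at_iff_sequentially comp_def by (intro AE_I2) blast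
  qed (use X meas bound g in auto)
qed

lemma continuous_on_integral_param:
  fixes f :: "real \<Rightarrow> 'b \<Rightarrow> 'c::{banach, second_countable_topology}"
  assumes "\<And>s. s \<in> S \<Longrightarrow> f s \<in> borel_measurable N"
    and "\<And>x. continuous_on S (\<lambda>s. f s x)"
    and "\<And>s x. s \<in> S \<Longrightarrow> norm (f s x) \<le> g x"
    and "integrable N g"
  shows "continuous_on S (\<lambda>s. LINT x|N. f s x)"
  unfolding continuous_on_def
  by (intro ballI tendsto_integral_param[where g=g])
     (use assms in \<open>auto simp: continuous_on_def\<close>)

text \<open>
  By the mean value inequality a bound on the derivative also dominates the difference quotients.
\<close>

lemma has_vector_derivative_integral_param:
  fixes f f' :: "real \<Rightarrow> 'b \<Rightarrow> 'c::{banach, second_countable_topology}"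
  assumes S: "open S" "convex S" "u \<in> S"
    and int: "\<And>s. s \<in> S \<Longrightarrow> integrable N (f s)"
    and der: "\<And>s x. s \<in> S \<Longrightarrow> ((\<lambda>s. f s x) has_vector_derivative f' s x) (at s)"
    and meas: "f' u \<in> borel_measurable N"
    and bound: "\<And>s x. s \<in> S \<Longrightarrow> norm (f' s x) \<le> g x"
    and g: "integrable N g"
  shows "((\<lambda>s. LINT x|N. f s x) has_vector_derivative (LINT x|N. f' u x)) (at u)"
proof -
  have lip: "norm (f s x - f u x) \<le> g x * \<bar>s - u\<bar>" if "s \<in> S" for s x
  proof -
    have "norm (f s x - f u x) \<le> g x * norm (s - u)"
    proof (rule differentiable_bound[OF S(2), where f'="\<lambda>s h. h *\<^sub>R f' s x"])
      show "((\<lambda>s. f s x) has_derivative (\<lambda>h. h *\<^sub>R f' y x)) (at y within S)" if "y \<in> S" for y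
        using der[OF that, of x] by (auto simp: has_vector_derivative_def intro: has_derivative_at_withinI)
      show "onorm (\<lambda>h. h *\<^sub>R f' y x) \<le> g x" if "y \<in> S" for y
        using bound[OF that, of x]
        by (intro onorm_le) (simp add: mult.commute[of "\<bar>_\<bar>"] mult_right_mono)
    qed (use S that in auto)
    thus ?thesis by simp
  qed
  let ?q = "\<lambda>s x. (f s x - f u x - (s - u) *\<^sub>R f' u x) /\<^sub>R norm (s - u)"
  have f'u: "integrable N (f' u)"
    by (rule Bochner_Integration.integrable_bound[OF g meas]) (use bound[OF S(3)] in \<open>auto intro!: AE_I2 intro: order.trans[OF _ abs_ge_self]\<close>)
  have "((\<lambda>s. LINT x|N. ?q s x) \<longlongrightarrow> (LINT x|N. 0)) (at u within S)"
  proof (rule tendsto_integral_param[where g="\<lambda>x. 2 * g x"])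
    show "?q s \<in> borel_measurable N" if "s \<in> S" for s
      using int[OF that] int[OF S(3)] meas by auto
    show "((\<lambda>s. ?q s x) \<longlongrightarrow> 0) (at u within S)" for x
      using der[OF S(3), of x] at_within_open[OF S(3,1)]
      by (simp add: has_vector_derivative_def has_derivative_at_within)
    show "norm (?q s x) \<le> 2 * g x" if "s \<in> S" "s \<noteq> u" for s x
    proof -
      have "norm (f s x - f u x - (s - u) *\<^sub>R f' u x) \<le> g x * \<bar>s - u\<bar> + \<bar>s - u\<bar> * norm (f' u x)"
        using lip[OF that(1), of x] norm_triangle_ineq4[of "f s x - f u x" "(s - u) *\<^sub>R f' u x"] by simp
      also have "\<dots> \<le> (2 * g x) * \<bar>s - u\<bar>"
        using mult_left_mono[OF bound[OF S(3), of x], of "\<bar>s - u\<bar>"] by (simp add: algebra_simps)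
      finally have "norm (f s x - f u x - (s - u) *\<^sub>R f' u x) / \<bar>s - u\<bar> \<le> 2 * g x"
        using that(2) by (simp add: pos_divide_le_eq del: scaleR_left_diff_distrib)
      thus ?thesis by (simp only: abs_inverse abs_idempotent norm_scaleR norm_inverse real_norm_def divide_inverse mult.commute)
    qed
  qed (use g in auto)
  hence "((\<lambda>s. LINT x|N. ?q s x) \<longlongrightarrow> 0) (at u)"
    using at_within_open[OF S(3,1)] by simp
  hence "((\<lambda>s. ((LINT x|N. f s x) - (LINT x|N. f u x) - (s - u) *\<^sub>R (LINT x|N. f' u x)) /\<^sub>R norm (s - u))
     \<longlongrightarrow> 0) (at u)"
  proof (rule Lim_transform_within_open[OF _ S(1,3)])
    fix s assume "s \<in> S"
    show "(LINT x|N. ?q s x) =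
      ((LINT x|N. f s x) - (LINT x|N. f u x) - (s - u) *\<^sub>R (LINT x|N. f' u x)) /\<^sub>R norm (s - u)"
      using int[OF \<open>s \<in> S\<close>] int[OF S(3)] f'u by simp
  qed
  thus ?thesis
    unfolding has_vector_derivative_def has_derivative_at_within
    by (simp add: bounded_linear_scaleR_left)
qed

section \<open>Integration against a Gaussian atom plus second-order jumps\<close>

lemma nn_integral_H_meas:
  assumes \<nu>: "sets \<nu> = sets borel" and f: "f \<in> borel_measurable borel"
  shows "(\<integral>\<^sup>+x. f x \<partial>H_meas a \<nu>) = ennreal a * f 0 + (\<integral>\<^sup>+x. ennreal (x\<^sup>2) * f x \<partial>\<nu>)"
  using f
proof (induction rule: borel_measurable_induct)
  case (cong f g)
  have [measurable_cong]: "space \<nu> = UNIV" "space (H_meas a \<nu>) = UNIV"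
    using sets_eq_imp_space_eq[OF \<nu>] sets_eq_imp_space_eq[OF sets_H_meas] by simp_all
  thus ?case using cong by simp
next
  case (set A)
  thus ?case using emeasure_H_meas[OF \<nu> set, of a] by simp
next
  case (mult u c)
  note [measurable_cong] = \<nu> sets_H_meas[of a \<nu>]
  show ?case using mult(2,4) by (simp add: nn_integral_cmult distrib_left mult.left_commute)
next
  case (add u v)
  note [measurable_cong] = \<nu> sets_H_meas[of a \<nu>]
  show ?case using add(1,3,4,6,7) by (simp add: nn_integral_add distrib_left add.assoc add.left_commute)
next
  case (seq U)
  note [measurable_cong] = \<nu> sets_H_meas[of a \<nu>]
  have inc: "incseq (\<lambda>i. U i x)" for x using seq(3) by (auto simp: incseq_def le_fun_def)
  have "(\<integral>\<^sup>+x. (SUP i. U i) x \<partial>H_meas a \<nu>) = (\<integral>\<^sup>+x. (SUP i. U i x) \<partial>H_meas a \<nu>)"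
    by (simp add: image_comp)
  also have "\<dots> = (SUP i. integral\<^sup>N (H_meas a \<nu>) (U i))"
    using seq by (intro nn_integral_monotone_convergence_SUP) (auto cong: measurable_cong_sets)
  also have "\<dots> = (SUP i. ennreal a * U i 0 + (\<integral>\<^sup>+x. ennreal (x\<^sup>2) * U i x \<partial>\<nu>))"
    using seq by simp
  also have "\<dots> = (SUP i. ennreal a * U i 0) + (SUP i. (\<integral>\<^sup>+x. ennreal (x\<^sup>2) * U i x \<partial>\<nu>))"
    using inc by (intro ennreal_SUP_add) (auto simp: incseq_def intro!: mult_left_mono nn_integral_mono)
  also have "(SUP i. ennreal a * U i 0) = ennreal a * (SUP i. U i 0)"
    by (simp add: SUP_mult_left_ennreal)
  also have "(SUP i. (\<integral>\<^sup>+x. ennreal (x\<^sup>2) * U i x \<partial>\<nu>)) = (\<integral>\<^sup>+x. (SUP i. ennreal (x\<^sup>2) * U i x) \<partial>\<nu>)"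
    using seq inc by (intro nn_integral_monotone_convergence_SUP[symmetric])
       (auto simp: incseq_def le_fun_def intro!: mult_left_mono)
  finally show ?case by (simp add: image_comp SUP_mult_left_ennreal)
qed

text \<open>
  The identity holds for indicators by the definition of the measure and passes to sums and dominated
  limits; it is needed for complex-valued functions, where \<open>nn_integral_H_meas\<close> does not apply.
\<close>

lemma integral_H_meas:
  fixes f :: "real \<Rightarrow> 'c::{banach, second_countable_topology}"
  assumes \<nu>: "sets \<nu> = sets borel" and a: "a \<ge> 0"
    and f: "f \<in> borel_measurable borel" "integrable \<nu> (\<lambda>x. x\<^sup>2 *\<^sub>R f x)"
  shows "integrable (H_meas a \<nu>) f"
    and "(LINT x|H_meas a \<nu>. f x) = a *\<^sub>R f 0 + (LINT x|\<nu>. x\<^sup>2 *\<^sub>R f x)"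
proof -
  note [measurable_cong] = \<nu> sets_H_meas[of a \<nu>]
  have eq: "(\<integral>\<^sup>+x. ennreal (norm (g x)) \<partial>H_meas a \<nu>) = ennreal (a * norm (g 0)) + (\<integral>\<^sup>+x. norm (x\<^sup>2 *\<^sub>R g x) \<partial>\<nu>)"
    if [measurable]: "g \<in> borel_measurable borel" for g :: "real \<Rightarrow> 'c"
    using a by (subst nn_integral_H_meas[OF \<nu>]) (auto simp: ennreal_mult)
  have meas: "borel_measurable (H_meas a \<nu>) = (borel_measurable borel :: (real \<Rightarrow> 'c) set)"
    by (intro measurable_cong_sets) auto
  have ii: "integrable \<nu> (\<lambda>x. x\<^sup>2 *\<^sub>R g x)" if g: "integrable (H_meas a \<nu>) g" for g :: "real \<Rightarrow> 'c"
  proof -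
    have [measurable]: "g \<in> borel_measurable borel" using g meas borel_measurable_integrable by metis
    show ?thesis
    proof (rule integrableI_bounded)
      have "(\<integral>\<^sup>+x. norm (g x) \<partial>H_meas a \<nu>) < \<infinity>" using g by (simp only: integrable_iff_bounded)
      thus "(\<integral>\<^sup>+x. norm (x\<^sup>2 *\<^sub>R g x) \<partial>\<nu>) < \<infinity>"
        unfolding eq[OF \<open>g \<in> borel_measurable borel\<close>] by simp
    qed measurable
  qed
  show i: "integrable (H_meas a \<nu>) f"
  proof (rule integrableI_bounded)
    have "(\<integral>\<^sup>+x. norm (x\<^sup>2 *\<^sub>R f x) \<partial>\<nu>) < \<infinity>" using f(2) by (simp only: integrable_iff_bounded)
    thus "(\<integral>\<^sup>+x. norm (f x) \<partial>H_meas a \<nu>) < \<infinity>" unfolding eq[OF f(1)] by simp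
  qed (simp add: meas f(1))
  from i show "(LINT x|H_meas a \<nu>. f x) = a *\<^sub>R f 0 + (LINT x|\<nu>. x\<^sup>2 *\<^sub>R f x)"
  proof (induction rule: integrable_induct)
    case (base A c)
    hence [measurable]: "A \<in> sets borel" by simp
    have iA: "integrable \<nu> (\<lambda>x. x\<^sup>2 *\<^sub>R (indicator A x :: real))"
    proof (rule integrableI_bounded)
      have "(\<integral>\<^sup>+x. norm (x\<^sup>2 *\<^sub>R (indicator A x :: real)) \<partial>\<nu>) = (\<integral>\<^sup>+x\<in>A. ennreal (x\<^sup>2) \<partial>\<nu>)"
        by (intro nn_integral_cong) (auto split: split_indicator)
      thus "(\<integral>\<^sup>+x. norm (x\<^sup>2 *\<^sub>R (indicator A x :: real)) \<partial>\<nu>) < \<infinity>"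
        using base(2) emeasure_H_meas[OF \<nu> \<open>A \<in> sets borel\<close>, of a] by simp
    qed measurable
    have "emeasure (H_meas a \<nu>) A = ennreal (a * indicator A 0) + (\<integral>\<^sup>+x. ennreal (x\<^sup>2 *\<^sub>R (indicator A x :: real)) \<partial>\<nu>)"
      using a by (subst emeasure_H_meas[OF \<nu> \<open>A \<in> sets borel\<close>])
         (auto simp: ennreal_mult ennreal_indicator split: split_indicator intro!: nn_integral_cong)
    also have "\<dots> = ennreal (a * indicator A 0 + (LINT x|\<nu>. x\<^sup>2 *\<^sub>R (indicator A x :: real)))"
      using a iA by (subst nn_integral_eq_integral) auto
    finally have m: "measure (H_meas a \<nu>) A = a * indicator A 0 + (LINT x|\<nu>. x\<^sup>2 *\<^sub>R (indicator A x :: real))"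
      unfolding measure_def using a
      by (simp only:) (intro enn2real_ennreal add_nonneg_nonneg mult_nonneg_nonneg Bochner_Integration.integral_nonneg; simp)
    have "(LINT x|\<nu>. x\<^sup>2 *\<^sub>R indicator A x *\<^sub>R c) = (LINT x|\<nu>. x\<^sup>2 *\<^sub>R (indicator A x :: real)) *\<^sub>R c"
      using iA by (subst integral_scaleR_left[symmetric]) auto
    thus ?case using base by (simp add: m scaleR_add_left)
  next
    case (add f g)
    thus ?case using ii[of f] ii[of g] by (simp add: scaleR_add_right)
  next
    case (lim f s)
    have [measurable]: "f \<in> borel_measurable borel" "\<And>i. s i \<in> borel_measurable borel"
      using borel_measurable_integrable[OF lim(4)] borel_measurable_integrable[OF lim(1)] meas by simp_all
    have L: "\<And>x. (\<lambda>i. s i x) \<longlonglongrightarrow> f x" using lim(2) sets_eq_imp_space_eq[OF sets_H_meas, of a \<nu>] by simp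
    have B: "norm (s i x) \<le> 2 * norm (f x)" for i x
      using lim(3) sets_eq_imp_space_eq[OF sets_H_meas, of a \<nu>] by simp
    have "(\<lambda>i. LINT x|\<nu>. x\<^sup>2 *\<^sub>R s i x) \<longlonglongrightarrow> (LINT x|\<nu>. x\<^sup>2 *\<^sub>R f x)"
    proof (rule integral_dominated_convergence[where w="\<lambda>x. 2 * norm (x\<^sup>2 *\<^sub>R f x)"])
      show "integrable \<nu> (\<lambda>x. 2 * norm (x\<^sup>2 *\<^sub>R f x))" using ii[OF lim(4)] by (intro integrable_mult_right integrable_norm)
      show "AE x in \<nu>. norm (x\<^sup>2 *\<^sub>R s i x) \<le> 2 * norm (x\<^sup>2 *\<^sub>R f x)" for i
        using mult_left_mono[OF B[of i], of "_\<^sup>2"] by (intro AE_I2) (simp add: mult.left_commute)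
    qed (auto intro!: tendsto_intros L)
    hence "(\<lambda>i. LINT x|H_meas a \<nu>. s i x) \<longlonglongrightarrow> a *\<^sub>R f 0 + (LINT x|\<nu>. x\<^sup>2 *\<^sub>R f x)"
      unfolding lim(5) by (intro tendsto_intros L)
    moreover have "(\<lambda>i. LINT x|H_meas a \<nu>. s i x) \<longlonglongrightarrow> (LINT x|H_meas a \<nu>. f x)"
      by (rule integral_dominated_convergence[where w="\<lambda>x. 2 * norm (f x)"])
         (use lim(1,4) L B in \<open>auto simp: integrable_norm\<close>)
    ultimately show ?case using LIMSEQ_unique by blast
  qed
qed

lemma Z_law_eq_density: "Z_law a \<nu> V = density (H_meas a \<nu>) (\<lambda>_. ennreal (1 / V))"
  unfolding Z_law_def by (rule measure_eqI) (auto simp: emeasure_density nn_integral_cmult_indicator)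

lemma sets_Z_law [simp]: "sets (Z_law a \<nu> V) = sets borel"
  by (simp add: Z_law_def)

lemma nn_integral_Z_law:
  assumes "sets \<nu> = sets borel" "f \<in> borel_measurable borel"
  shows "(\<integral>\<^sup>+x. f x \<partial>Z_law a \<nu> V) =
    ennreal (1 / V) * (ennreal a * f 0 + (\<integral>\<^sup>+x. ennreal (x\<^sup>2) * f x \<partial>\<nu>))"
  unfolding Z_law_def
  by (subst nn_integral_scale_measure) (use assms in \<open>auto simp: nn_integral_H_meas cong: measurable_cong_sets\<close>)

lemma integral_Z_law:
  fixes f :: "real \<Rightarrow> 'c::{banach, second_countable_topology}"
  assumes \<nu>: "sets \<nu> = sets borel" and a: "a \<ge> 0" and V: "V > 0"
    and f: "f \<in> borel_measurable borel" "integrable \<nu> (\<lambda>x. x\<^sup>2 *\<^sub>R f x)"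
  shows "integrable (Z_law a \<nu> V) f"
    and "V *\<^sub>R (LINT x|Z_law a \<nu> V. f x) = a *\<^sub>R f 0 + (LINT x|\<nu>. x\<^sup>2 *\<^sub>R f x)"
proof -
  have [measurable]: "f \<in> borel_measurable (H_meas a \<nu>)"
    using f(1) by (simp cong: measurable_cong_sets)
  note H = integral_H_meas[OF \<nu> a f]
  show "integrable (Z_law a \<nu> V) f"
    unfolding Z_law_eq_density using V H(1) by (subst integrable_density) auto
  show "V *\<^sub>R (LINT x|Z_law a \<nu> V. f x) = a *\<^sub>R f 0 + (LINT x|\<nu>. x\<^sup>2 *\<^sub>R f x)"
    unfolding Z_law_eq_density using V H by (subst integral_density) auto
qed

lemma prob_space_Z_law:
  assumes \<nu>: "sets \<nu> = sets borel" and a: "a \<ge> 0" and V: "V > 0"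
    and i: "integrable \<nu> (\<lambda>x. x\<^sup>2)" and eq: "V = a + (LINT x|\<nu>. x\<^sup>2)"
  shows "prob_space (Z_law a \<nu> V)"
proof
  have "emeasure (Z_law a \<nu> V) (space (Z_law a \<nu> V)) = (\<integral>\<^sup>+x. 1 \<partial>Z_law a \<nu> V)"
    by simp
  also have "\<dots> = ennreal (1 / V) * (ennreal a + ennreal (LINT x|\<nu>. x\<^sup>2))"
    using i by (subst nn_integral_Z_law[OF \<nu>]) (auto simp: nn_integral_eq_integral)
  also have "\<dots> = ennreal (1 / V * (a + (LINT x|\<nu>. x\<^sup>2)))"
    using a V by (simp add: ennreal_mult'[symmetric] ennreal_plus[symmetric] del: ennreal_plus)
  finally show "emeasure (Z_law a \<nu> V) (space (Z_law a \<nu> V)) = 1" using V eq by simp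
qed

section \<open>Products of independent factors\<close>

definition product_law :: "real measure \<Rightarrow> real measure \<Rightarrow> real measure" where
  "product_law U P = distr (U \<Otimes>\<^sub>M P) borel (\<lambda>(b, z). b * z)"

lemma R_law_eq_product_law: "R_law a \<nu> V = product_law beta_1_2 (Z_law a \<nu> V)"
  by (simp add: R_law_def product_law_def)

lemma sets_product_law [simp]: "sets (product_law U P) = sets borel"
  by (simp add: product_law_def)

context
  fixes U P :: "real measure"
  assumes U: "prob_space U" "sets U = sets borel" and P: "prob_space P" "sets P = sets borel"
begin

interpretation U: prob_space U by (rule U)
interpretation P: prob_space P by (rule P)
interpretation UP: pair_prob_space U P ..

lemma real_distribution_product_law: "real_distribution (product_law U P)"
proof -
  note [measurable_cong] = U(2) P(2)
  show ?thesis unfolding product_law_def by (rule UP.real_distribution_distr) measurable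
qed

lemma nn_integral_product_law:
  assumes [measurable]: "f \<in> borel_measurable borel"
  shows "(\<integral>\<^sup>+x. f x \<partial>product_law U P) = (\<integral>\<^sup>+z. \<integral>\<^sup>+b. f (b * z) \<partial>U \<partial>P)"
proof -
  note [measurable_cong] = U(2) P(2)
  show ?thesis
    unfolding product_law_def
    by (subst nn_integral_distr) (auto simp: split_beta' UP.nn_integral_snd[symmetric])
qed

lemma integral_product_law:
  fixes f :: "real \<Rightarrow> 'c::{banach, second_countable_topology}"
  assumes f: "integrable (product_law U P) f"
  shows "(LINT x|product_law U P. f x) = (LINT z|P. LINT b|U. f (b * z))"
proof -
  note [measurable_cong] = U(2) P(2)
  have [measurable]: "f \<in> borel_measurable borel"
    using borel_measurable_integrable[OF f] by (simp cong: measurable_cong_sets)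
  have "integrable (U \<Otimes>\<^sub>M P) (\<lambda>(b, z). f (b * z))"
    using f unfolding product_law_def by (subst (asm) integrable_distr_eq) (auto simp: split_beta')
  thus ?thesis
    unfolding product_law_def
    by (subst integral_distr) (auto simp: split_beta' UP.integral_snd[where f="\<lambda>b z. f (b * z)"])
qed

end

definition uniform_01 :: "real measure" where
  "uniform_01 = density lborel (\<lambda>b. ennreal (indicator {0..1} b))"

lemma sets_uniform_01 [simp, measurable_cong]: "sets uniform_01 = sets borel"
  by (simp add: uniform_01_def)

lemma sets_beta_1_2 [simp, measurable_cong]: "sets beta_1_2 = sets borel"
  by (simp add: beta_1_2_def)

lemma nn_integral_uniform_01:
  assumes [measurable]: "f \<in> borel_measurable borel"
  shows "(\<integral>\<^sup>+b. f b \<partial>uniform_01) = (\<integral>\<^sup>+b. f b * indicator {0..1} b \<partial>lborel)"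
  unfolding uniform_01_def
  by (subst nn_integral_density) (auto intro!: nn_integral_cong split: split_indicator)

lemma prob_space_uniform_01: "prob_space uniform_01"
proof
  have "(\<integral>\<^sup>+b. 1 \<partial>uniform_01) = 1"
    by (subst nn_integral_uniform_01) auto
  thus "emeasure uniform_01 (space uniform_01) = 1" by simp
qed

text \<open>
  Averaging the derivative of \<open>x e\<^sup>b\<^sup>t\<^sup>x\<close> over \<open>b \<in> [0,1]\<close> yields the increment \<open>x (e\<^sup>t\<^sup>x - 1)\<close>. The factors \<open>t\<close>
  and \<open>x\<^sup>2\<close> stay on the left, which avoids a separate formula at \<open>x = 0\<close>.
\<close>

lemma nn_integral_uniform_01_exp:
  assumes t: "t > 0"
  shows "ennreal t * (ennreal (x\<^sup>2) * (\<integral>\<^sup>+b. ennreal (exp (t * (b * x))) \<partial>uniform_01)) = ennreal (x * (exp (t * x) - 1))"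
proof -
  have "ennreal t * (ennreal (x\<^sup>2) * (\<integral>\<^sup>+b. ennreal (exp (t * (b * x))) \<partial>uniform_01)) =
      (\<integral>\<^sup>+b. ennreal (t * x\<^sup>2 * exp (t * (b * x))) * indicator {0..1} b \<partial>lborel)"
    using t by (subst nn_integral_uniform_01)
      (auto simp: nn_integral_cmult[symmetric] ennreal_mult mult.assoc)
  also have "\<dots> = ennreal (x * exp (t * (1 * x)) - x * exp (t * (0 * x)))"
    using t by (intro nn_integral_FTC_Icc[where F="\<lambda>b. x * exp (t * (b * x))"])
      (auto intro!: derivative_eq_intros simp: power2_eq_square)
  finally show ?thesis by (simp add: algebra_simps)
qed

lemma nn_integral_beta_1_2:
  assumes [measurable]: "f \<in> borel_measurable borel"
  shows "(\<integral>\<^sup>+b. f b \<partial>beta_1_2) = (\<integral>\<^sup>+b. ennreal (2 * (1 - b)) * f b * indicator {0..1} b \<partial>lborel)"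
  unfolding beta_1_2_def
proof (subst nn_integral_density)
  show "(\<integral>\<^sup>+b. ennreal (2 * (1 - b)) * indicator {0<..<1} b * f b \<partial>lborel) =
      (\<integral>\<^sup>+b. ennreal (2 * (1 - b)) * f b * indicator {0..1} b \<partial>lborel)"
    using AE_lborel_singleton[of "0::real"] AE_lborel_singleton[of "1::real"]
    by (intro nn_integral_cong_AE) (auto elim!: eventually_elim2 split: split_indicator)
qed auto

lemma prob_space_beta_1_2: "prob_space beta_1_2"
proof
  have "(\<integral>\<^sup>+b. ennreal (2 * (1 - b)) * indicator {0..1} b \<partial>lborel) = ennreal ((2*1 - 1^2) - (2*0-0^2))"
    by (intro nn_integral_FTC_Icc[where F="\<lambda>b. 2 * b - b\<^sup>2"]) (auto intro!: derivative_eq_intros)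
  hence "(\<integral>\<^sup>+b. 1 \<partial>beta_1_2) = 1"
    by (subst nn_integral_beta_1_2) auto
  thus "emeasure beta_1_2 (space beta_1_2) = 1" by simp
qed

text \<open>
  Taylor's formula of order two with integral remainder: the Beta(1,2) density is the kernel \<open>2 (1 - b)\<close> of
  the remainder. This is why the factor \<open>B\<close> of \<open>R = B Z\<close> turns the second-order measure \<open>x\<^sup>2 \<nu>(dx)\<close> back into
  the compensated exponential.
\<close>

lemma nn_integral_beta_1_2_exp:
  assumes t: "t > 0"
  shows "ennreal (t\<^sup>2 / 2) * (ennreal (x\<^sup>2) * (\<integral>\<^sup>+b. ennreal (exp (t * (b * x))) \<partial>beta_1_2)) = ennreal (exp (t * x) - 1 - t * x)"
proof -
  have pos: "0 \<le> x * (x * exp y)" for y :: real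
    by (simp add: mult.assoc[symmetric])
  have "ennreal (t\<^sup>2 / 2) * (ennreal (x\<^sup>2) * (\<integral>\<^sup>+b. ennreal (exp (t * (b * x))) \<partial>beta_1_2)) =
      (\<integral>\<^sup>+b. ennreal ((1 - b) * t\<^sup>2 * x\<^sup>2 * exp (t * (b * x))) * indicator {0..1} b \<partial>lborel)"
    using t by (subst nn_integral_beta_1_2)
      (auto simp: nn_integral_cmult[symmetric] ennreal_mult'[symmetric] mult_ac split: split_indicator intro!: nn_integral_cong)
  also have "\<dots> = ennreal ((1 + t * x - 1 * t * x) * exp (t * (1 * x)) - (1 + t * x - 0 * t * x) * exp (t * (0 * x)))"
    using t by (intro nn_integral_FTC_Icc[where F="\<lambda>b. (1 + t * x - b * t * x) * exp (t * (b * x))"])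
      (auto intro!: derivative_eq_intros simp: power2_eq_square algebra_simps mult_left_le_one_le pos)
  finally show ?thesis by (simp add: algebra_simps)
qed

lemma has_vector_derivative_iexp_mult:
  "((\<lambda>u. iexp (u * x)) has_vector_derivative \<i> * of_real x * iexp (u * x)) (at u within A)"
proof -
  have "((\<lambda>u. u * x) has_vector_derivative x) (at u within A)"
    by (auto intro!: derivative_eq_intros simp: has_real_derivative_iff_has_vector_derivative[symmetric])
  from vector_diff_chain_within[OF this has_vector_derivative_iexp]
  show ?thesis by (simp add: o_def scaleR_conv_of_real mult_ac)
qed

text \<open>
  The analogue of \<open>nn_integral_uniform_01_exp\<close> on the imaginary axis.
\<close>

lemma integral_uniform_01_iexp:
  "\<i> * of_real u * (of_real (x\<^sup>2) * (LINT b|uniform_01. iexp (u * (b * x)))) = of_real x * (iexp (u * x) - 1)"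
proof -
  have "\<i> * of_real u * (of_real (x\<^sup>2) * (LINT b|uniform_01. iexp (u * (b * x)))) =
     of_real x * (LINT b|lborel. indicator {0..1} b *\<^sub>R (\<i> * of_real (u * x) * iexp (u * (b * x))))"
    unfolding uniform_01_def
    by (subst integral_density) (auto simp: power2_eq_square mult.left_commute[of _ "indicator _ _ *\<^sub>R _"] mult_ac scaleR_conv_of_real
      simp flip: Bochner_Integration.integral_mult_right_zero)
  also have "(LINT b|lborel. indicator {0..1} b *\<^sub>R (\<i> * of_real (u * x) * iexp (u * (b * x)))) =
     iexp (u * (1 * x)) - iexp (u * (0 * x))"
  proof (intro integral_FTC_Icc)
    fix b :: real
    show "((\<lambda>b. iexp (u * (b * x))) has_vector_derivative \<i> * of_real (u * x) * iexp (u * (b * x))) (at b within {0..1})"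
      using has_vector_derivative_iexp_mult[of "u * x" b] by (simp add: mult.left_commute)
  qed (auto intro!: continuous_intros)
  finally show ?thesis by simp
qed

section \<open>Derivatives of compensated Fourier integrals\<close>

lemma vector_derivative_eq_on_open:
  assumes "open S" "\<And>u. u \<in> S \<Longrightarrow> f u = g u" "\<And>u. (g has_vector_derivative g' u) (at u)" "u \<in> S"
  shows "vector_derivative f (at u) = g' u"
  by (rule vector_derivative_at[OF has_vector_derivative_transform_within_open[OF assms(3,1,4)]])
     (use assms(2) in auto)

lemma norm_iexp_minus_1: "norm (iexp y - 1) \<le> \<bar>y\<bar>"
  using iexp_approx1[of y 0] by simp

lemma norm_iexp_minus_1_minus: "norm (iexp y - 1 - \<i> * of_real y) \<le> y\<^sup>2 / 2"
  using iexp_approx1[of y 1] by (simp add: power2_eq_square diff_diff_eq)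

text \<open>
  The jump part of the Levy exponent, with full compensation.
\<close>

definition iexp_excess :: "real measure \<Rightarrow> real \<Rightarrow> complex" where
  "iexp_excess N u = (LINT x|N. iexp (u * x) - 1 - \<i> * of_real (u * x))"

context
  fixes N :: "real measure"
  assumes N [measurable_cong]: "sets N = sets borel" and sq: "integrable N (\<lambda>x. x\<^sup>2)"
begin

lemma integrable_iexp_excess: "integrable N (\<lambda>x. iexp (u * x) - 1 - \<i> * of_real (u * x))"
proof (rule Bochner_Integration.integrable_bound)
  show "integrable N (\<lambda>x. u\<^sup>2 / 2 * x\<^sup>2)" using sq by simp
  show "AE x in N. norm (iexp (u * x) - 1 - \<i> * of_real (u * x)) \<le> norm (u\<^sup>2 / 2 * x\<^sup>2)"
    using norm_iexp_minus_1_minus[of "u * _"] by (intro AE_I2) (simp add: power_mult_distrib)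
qed measurable

lemma integrable_iexp_increment: "integrable N (\<lambda>x. of_real x * (iexp (u * x) - 1))"
proof (rule Bochner_Integration.integrable_bound)
  show "integrable N (\<lambda>x. \<bar>u\<bar> * x\<^sup>2)" using sq by simp
  show "AE x in N. norm (of_real x * (iexp (u * x) - 1)) \<le> norm (\<bar>u\<bar> * x\<^sup>2)"
    using mult_left_mono[OF norm_iexp_minus_1[of "u * _"] abs_ge_zero]
    by (intro AE_I2) (simp add: norm_mult abs_mult power2_eq_square mult_ac del: mult_le_cancel_left)
qed measurable

lemma iexp_excess_deriv:
  "(iexp_excess N has_vector_derivative \<i> * (LINT x|N. of_real x * (iexp (u * x) - 1))) (at u)"
proof -
  let ?r = "\<bar>u\<bar> + 1"
  have "((\<lambda>u. LINT x|N. iexp (u * x) - 1 - \<i> * of_real (u * x)) has_vector_derivative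
     (LINT x|N. \<i> * (of_real x * (iexp (u * x) - 1)))) (at u)"
  proof (rule has_vector_derivative_integral_param[where S="{-?r<..<?r}" and g="\<lambda>x. ?r * x\<^sup>2"])
    fix s x assume s: "s \<in> {-?r<..<?r}"
    have "norm (iexp (s * x) - 1) * \<bar>x\<bar> \<le> (?r * \<bar>x\<bar>) * \<bar>x\<bar>"
      using s by (intro mult_right_mono order.trans[OF norm_iexp_minus_1]) (auto simp: abs_mult intro!: mult_right_mono)
    thus "norm (\<i> * (of_real x * (iexp (s * x) - 1))) \<le> ?r * x\<^sup>2"
      by (simp add: norm_mult mult_ac power2_eq_square)
    have "((\<lambda>s. \<i> * of_real (s * x)) has_vector_derivative \<i> * of_real x) (at s)"
      by (auto intro!: derivative_eq_intros simp: has_vector_derivative_def scaleR_conv_of_real mult_ac)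
    thus "((\<lambda>s. iexp (s * x) - 1 - \<i> * of_real (s * x)) has_vector_derivative \<i> * (of_real x * (iexp (s * x) - 1))) (at s)"
      by (intro has_vector_derivative_eq_rhs[OF has_vector_derivative_diff[OF has_vector_derivative_diff[OF has_vector_derivative_iexp_mult has_vector_derivative_const]]])
         (auto simp: algebra_simps)
  qed (use sq integrable_iexp_excess in auto)
  moreover have "(LINT x|N. \<i> * (of_real x * (iexp (u * x) - 1))) = \<i> * (LINT x|N. of_real x * (iexp (u * x) - 1))"
    by simp
  ultimately show ?thesis by (simp add: iexp_excess_def[abs_def])
qed

lemma iexp_increment_deriv:
  "((\<lambda>u. LINT x|N. of_real x * (iexp (u * x) - 1)) has_vector_derivative
     \<i> * (LINT x|N. of_real (x\<^sup>2) * iexp (u * x))) (at u)"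
proof -
  have "((\<lambda>u. LINT x|N. of_real x * (iexp (u * x) - 1)) has_vector_derivative
     (LINT x|N. \<i> * (of_real (x\<^sup>2) * iexp (u * x)))) (at u)"
  proof (rule has_vector_derivative_integral_param[where S=UNIV and g="\<lambda>x. x\<^sup>2"])
    fix s x :: real
    show "norm (\<i> * (of_real (x\<^sup>2) * iexp (s * x))) \<le> x\<^sup>2"
      by (simp add: norm_mult norm_power)
    show "((\<lambda>s. of_real x * (iexp (s * x) - 1)) has_vector_derivative \<i> * (of_real (x\<^sup>2) * iexp (s * x))) (at s)"
      by (rule has_vector_derivative_eq_rhs[OF has_vector_derivative_mult_right[OF
             has_vector_derivative_diff[OF has_vector_derivative_iexp_mult has_vector_derivative_const]]])
         (simp add: power2_eq_square)
  qed (use sq integrable_iexp_increment in auto)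
  thus ?thesis by simp
qed

lemma iexp_second_moment_deriv:
  assumes cube: "integrable N (\<lambda>x. x ^ 3)"
  shows "((\<lambda>u. LINT x|N. of_real (x\<^sup>2) * iexp (u * x)) has_vector_derivative
     \<i> * (LINT x|N. of_real (x ^ 3) * iexp (u * x))) (at u)"
proof -
  have "((\<lambda>u. LINT x|N. of_real (x\<^sup>2) * iexp (u * x)) has_vector_derivative
     (LINT x|N. \<i> * (of_real (x ^ 3) * iexp (u * x)))) (at u)"
  proof (rule has_vector_derivative_integral_param[where S=UNIV and g="\<lambda>x. \<bar>x ^ 3\<bar>"])
    fix s x :: real
    show "norm (\<i> * (of_real (x ^ 3) * iexp (s * x))) \<le> \<bar>x ^ 3\<bar>"
      by (simp add: norm_mult norm_power power_abs)
    show "((\<lambda>s. of_real (x\<^sup>2) * iexp (s * x)) has_vector_derivative \<i> * (of_real (x ^ 3) * iexp (s * x))) (at s)"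
      by (rule has_vector_derivative_eq_rhs[OF has_vector_derivative_mult_right[OF has_vector_derivative_iexp_mult]])
         (simp add: power2_eq_square power3_eq_cube)
    show "integrable N (\<lambda>x. of_real (x\<^sup>2) * iexp (s * x))"
      by (rule Bochner_Integration.integrable_bound[OF sq]) (auto simp: norm_mult norm_power)
  qed (use cube in auto)
  thus ?thesis by simp
qed

end

section \<open>Characteristic functions and the zero-bias identity\<close>

text \<open>
  Both the square-biased law \<open>x\<^sup>2 \<mu>(dx) / V\<close> and the normalised measure \<open>(a \<delta>\<^sub>0 + x\<^sup>2 \<nu>(dx)) / V\<close> are instances of
  \<open>Z_law\<close>, so this one formula computes both sides of the zero-bias identity below.
\<close>

lemma char_product_law_uniform:
  assumes \<nu> [measurable_cong]: "sets \<nu> = sets borel" and a: "a \<ge> 0" and V: "V > 0"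
    and sq: "integrable \<nu> (\<lambda>x. x\<^sup>2)" and eq: "V = a + (LINT x|\<nu>. x\<^sup>2)"
  shows "\<i> * of_real (u * V) * char (product_law uniform_01 (Z_law a \<nu> V)) u =
    \<i> * of_real (a * u) + (LINT x|\<nu>. of_real x * (iexp (u * x) - 1))"
proof -
  let ?f = "\<lambda>z. LINT b|uniform_01. iexp (u * (b * z))"
  note Z = prob_space_Z_law[OF \<nu> a V sq eq]
  note mix = prob_space_uniform_01 sets_uniform_01 Z sets_Z_law
  interpret m: real_distribution "product_law uniform_01 (Z_law a \<nu> V)"
    by (rule real_distribution_product_law[OF mix])
  interpret U: prob_space uniform_01 by (rule prob_space_uniform_01)
  have [measurable]: "?f \<in> borel_measurable borel"
    by (intro U.borel_measurable_lebesgue_integral) measurable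
  have le: "norm (?f z) \<le> 1" for z
  proof -
    have "norm (?f z) \<le> (LINT b|uniform_01. norm (iexp (u * (b * z))))" by (rule integral_norm_bound)
    thus ?thesis by (simp add: U.prob_space)
  qed
  have int: "integrable \<nu> (\<lambda>x. x\<^sup>2 *\<^sub>R ?f x)"
    by (rule Bochner_Integration.integrable_bound[OF sq])
       (use le in \<open>auto simp: mult_left_le intro!: AE_I2\<close>)
  have "char (product_law uniform_01 (Z_law a \<nu> V)) u = (LINT z|Z_law a \<nu> V. ?f z)"
    unfolding char_def by (rule integral_product_law[OF mix]) (rule m.integrable_iexp, simp_all)
  hence "\<i> * of_real (u * V) * char (product_law uniform_01 (Z_law a \<nu> V)) u =
      \<i> * of_real u * (V *\<^sub>R (LINT z|Z_law a \<nu> V. ?f z))"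
    by (simp add: scaleR_conv_of_real mult_ac)
  also have "\<dots> = \<i> * of_real u * (a *\<^sub>R ?f 0 + (LINT x|\<nu>. x\<^sup>2 *\<^sub>R ?f x))"
    by (subst integral_Z_law(2)[OF \<nu> a V _ int]) auto
  also have "?f 0 = 1" by (simp add: U.prob_space)
  also have "\<i> * of_real u * (a *\<^sub>R 1 + (LINT x|\<nu>. x\<^sup>2 *\<^sub>R ?f x)) =
    \<i> * of_real (a * u) + (LINT x|\<nu>. \<i> * of_real u * (of_real (x\<^sup>2) * ?f x))"
    using int by (simp add: scaleR_conv_of_real algebra_simps)
  finally show ?thesis unfolding integral_uniform_01_iexp .
qed

lemma char_convolution:
  assumes "real_distribution M" "real_distribution N"
  shows "char (M \<star> N) u = char M u * char N u"
proof -
  interpret M: real_distribution M by fact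
  interpret N: real_distribution N by fact
  interpret MN: pair_prob_space M N ..
  have [measurable_cong]: "sets M = sets borel" "sets N = sets borel" by simp_all
  have int: "integrable (M \<Otimes>\<^sub>M N) (\<lambda>(x, y). iexp (u * (x + y)))"
    unfolding split_beta' by (rule MN.integrable_iexp) measurable
  have "char (M \<star> N) u = (LINT p|(M \<Otimes>\<^sub>M N). (case p of (x, y) \<Rightarrow> iexp (u * (x + y))))"
    unfolding char_def convolution_def by (subst integral_distr) (auto simp: split_beta')
  also have "\<dots> = (LINT x|M. LINT y|N. iexp (u * (x + y)))"
    using MN.integral_fst[OF int] by simp
  also have "\<dots> = (LINT x|M. iexp (u * x) * char N u)"
    unfolding char_def by (simp add: distrib_left exp_add)
  also have "\<dots> = char M u * char N u"
    by (simp add: char_def)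
  finally show ?thesis .
qed

lemma real_distribution_convolution:
  assumes "real_distribution M" "real_distribution N"
  shows "real_distribution (M \<star> N)"
proof -
  interpret M: real_distribution M by fact
  interpret N: real_distribution N by fact
  interpret MN: pair_prob_space M N ..
  have [measurable_cong]: "sets M = sets borel" "sets N = sets borel" by simp_all
  show ?thesis unfolding convolution_def by (rule MN.real_distribution_distr) measurable
qed

lemma char_eq_iexp_excess:
  assumes "real_distribution \<mu>" "integrable \<mu> (\<lambda>x. x\<^sup>2)" "(LINT x|\<mu>. x) = 0"
  shows "char \<mu> u = 1 + iexp_excess \<mu> u"
proof -
  interpret real_distribution \<mu> by fact
  have i: "integrable \<mu> (\<lambda>x. x)"
    by (rule square_integrable_imp_integrable[OF _ assms(2)]) simp
  have "integrable \<mu> (\<lambda>x. iexp (u * x))" by (rule integrable_iexp) auto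
  hence "iexp_excess \<mu> u = char \<mu> u - 1 - (LINT x|\<mu>. \<i> * of_real u * of_real x)"
    using i by (simp add: iexp_excess_def char_def prob_space[unfolded space_eq_univ] mult.assoc)
  also have "(LINT x|\<mu>. \<i> * of_real u * of_real x) = \<i> * of_real u * of_real (LINT x|\<mu>. x)"
    using i by (simp del: of_real_mult)
  finally show ?thesis using assms(3) by simp
qed

locale centered_levy = real_distribution \<mu> for \<mu> :: "real measure" +
  fixes a V :: real and \<nu> :: "real measure"
  assumes second_moment: "integrable \<mu> (\<lambda>x. x\<^sup>2)"
    and mean: "(LINT x|\<mu>. x) = 0"
    and variance_eq: "V = (LINT x|\<mu>. x\<^sup>2)"
    and variance_pos: "V > 0"
    and levy: "has_levy_characteristics \<mu> a \<nu>"
    and third_moment: "(\<integral>\<^sup>+x\<in>{x. \<bar>x\<bar> > 1}. ennreal (\<bar>x\<bar> ^ 3) \<partial>\<nu>) < \<infinity>"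
begin

lemma sets_\<nu> [measurable_cong]: "sets \<nu> = sets borel"
  and gaussian_nonneg: "a \<ge> 0"
  using levy by (auto simp: has_levy_characteristics_def levy_measure_def)

lemma integrable_first: "integrable \<mu> (\<lambda>x. x)"
  by (rule square_integrable_imp_integrable[OF _ second_moment]) simp

lemma integrable_levy_dominated:
  fixes f :: "real \<Rightarrow> real"
  assumes [measurable]: "f \<in> borel_measurable borel"
    and le: "\<And>x. \<bar>x\<bar> \<le> 1 \<Longrightarrow> \<bar>f x\<bar> \<le> x\<^sup>2" "\<And>x. \<bar>x\<bar> > 1 \<Longrightarrow> \<bar>f x\<bar> \<le> \<bar>x\<bar> ^ 3"
  shows "integrable \<nu> f"
proof (rule integrableI_bounded)
  have "(\<integral>\<^sup>+x. ennreal (norm (f x)) \<partial>\<nu>) \<le>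
     (\<integral>\<^sup>+x. ennreal (min 1 (x\<^sup>2)) + ennreal (\<bar>x\<bar> ^ 3) * indicator {x. \<bar>x\<bar> > 1} x \<partial>\<nu>)"
  proof (rule nn_integral_mono)
    fix x :: real
    show "ennreal (norm (f x)) \<le> ennreal (min 1 (x\<^sup>2)) + ennreal (\<bar>x\<bar> ^ 3) * indicator {x. \<bar>x\<bar> > 1} x"
    proof (cases "\<bar>x\<bar> \<le> 1")
      case True
      hence "x\<^sup>2 \<le> 1" by (simp add: abs_square_le_1)
      thus ?thesis using True le(1)[OF True] by (simp add: min_absorb2 ennreal_leI)
    next
      case False
      hence "ennreal (norm (f x)) \<le> ennreal (\<bar>x\<bar> ^ 3) * indicator {x. \<bar>x\<bar> > 1} x"
        using le(2)[of x] by (simp add: ennreal_leI)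
      thus ?thesis by (simp add: add_increasing)
    qed
  qed
  also have "\<dots> = (\<integral>\<^sup>+x. ennreal (min 1 (x\<^sup>2)) \<partial>\<nu>) + (\<integral>\<^sup>+x\<in>{x. \<bar>x\<bar> > 1}. ennreal (\<bar>x\<bar> ^ 3) \<partial>\<nu>)"
    by (intro nn_integral_add) auto
  also have "\<dots> < \<infinity>"
    using third_moment levy by (auto simp: has_levy_characteristics_def levy_measure_def)
  finally show "(\<integral>\<^sup>+x. ennreal (norm (f x)) \<partial>\<nu>) < \<infinity>" .
qed simp

lemma levy_second_moment: "integrable \<nu> (\<lambda>x. x\<^sup>2)"
proof (rule integrable_levy_dominated)
  fix x :: real assume "\<bar>x\<bar> > 1"
  thus "\<bar>x\<^sup>2\<bar> \<le> \<bar>x\<bar> ^ 3" using power_increasing[of 2 3 "\<bar>x\<bar>"] by simp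
qed auto

lemma levy_third_moment: "integrable \<nu> (\<lambda>x. x ^ 3)"
proof (rule integrable_levy_dominated)
  fix x :: real assume "\<bar>x\<bar> \<le> 1"
  thus "\<bar>x ^ 3\<bar> \<le> x\<^sup>2" using power_decreasing[of 2 3 "\<bar>x\<bar>"] by (simp add: power_abs)
qed (auto simp: power_abs)

text \<open>
  The truncation \<open>1\<^bsub>[-1,1]\<^esub>\<close> in the exponent can be replaced by full compensation because large jumps are
  integrable; the difference is absorbed into the drift.
\<close>

lemma char_exponent_drift:
  obtains d where "\<And>u. char \<mu> u = exp (\<i> * of_real (d * u) + (- of_real (a * u\<^sup>2 / 2) + iexp_excess \<nu> u))"
proof -
  from levy obtain d where d: "\<And>u. char \<mu> u =
        exp (\<i> * of_real (d * u) - of_real (a * u\<^sup>2 / 2)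
             + (LINT x|\<nu>. iexp (u * x) - 1 - \<i> * of_real (u * x * indicator {-1..1} x)))"
    by (auto simp: has_levy_characteristics_def)
  define c where "c = (LINT x|\<nu>. x * indicator (-{-1..1}) x)"
  have i: "integrable \<nu> (\<lambda>x. x * indicator (-{-1..1}) x :: real)"
  proof (rule integrable_levy_dominated)
    fix x :: real assume "\<bar>x\<bar> > 1"
    thus "\<bar>x * indicator (-{-1..1}) x\<bar> \<le> \<bar>x\<bar> ^ 3"
      using power_increasing[of 1 3 "\<bar>x\<bar>"] by (simp split: split_indicator)
  qed (auto split: split_indicator)
  have "(LINT x|\<nu>. iexp (u * x) - 1 - \<i> * of_real (u * x * indicator {-1..1} x)) =
      iexp_excess \<nu> u + \<i> * of_real (u * c)" for u
  proof -
    have "(LINT x|\<nu>. iexp (u * x) - 1 - \<i> * of_real (u * x * indicator {-1..1} x)) =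
      (LINT x|\<nu>. (iexp (u * x) - 1 - \<i> * of_real (u * x)) + \<i> * of_real u * of_real (x * indicator (-{-1..1}) x))"
      by (intro Bochner_Integration.integral_cong) (auto split: split_indicator simp: algebra_simps)
    also have "\<dots> = iexp_excess \<nu> u + \<i> * of_real u * (LINT x|\<nu>. of_real (x * indicator (-{-1..1}) x))"
      unfolding iexp_excess_def using i integrable_iexp_excess[OF sets_\<nu> levy_second_moment, of u]
      by (subst Bochner_Integration.integral_add) (auto simp del: of_real_mult)
    also have "(LINT x|\<nu>. complex_of_real (x * indicator (-{-1..1}) x)) = of_real c"
      unfolding c_def by (rule integral_complex_of_real)
    finally show ?thesis by simp
  qed
  hence "char \<mu> u = exp (\<i> * of_real (d * u) - of_real (a * u\<^sup>2 / 2) + (iexp_excess \<nu> u + \<i> * of_real (u * c)))" for u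
    by (simp only: d)
  hence "char \<mu> u = exp (\<i> * of_real ((d + c) * u) + (- of_real (a * u\<^sup>2 / 2) + iexp_excess \<nu> u))" for u
    by (simp add: algebra_simps)
  thus thesis using that by blast
qed

abbreviation iexp_increment :: "real measure \<Rightarrow> real \<Rightarrow> complex" where
  "iexp_increment N u \<equiv> (LINT x|N. of_real x * (iexp (u * x) - 1))"

lemma char_deriv: "(char \<mu> has_vector_derivative \<i> * iexp_increment \<mu> u) (at u)"
proof -
  have "char \<mu> = (\<lambda>u. 1 + iexp_excess \<mu> u)"
    using char_eq_iexp_excess[OF _ second_moment mean] real_distribution_axioms by blast
  moreover have "((\<lambda>u. 1 + iexp_excess \<mu> u) has_vector_derivative \<i> * iexp_increment \<mu> u) (at u)"
    using has_vector_derivative_add[OF has_vector_derivative_const iexp_excess_deriv[OF _ second_moment]] by simp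
  ultimately show ?thesis by simp
qed

lemma levy_exponent_deriv:
  "((\<lambda>u. - of_real (a * u\<^sup>2 / 2) + iexp_excess \<nu> u) has_vector_derivative
    - of_real (a * u) + \<i> * iexp_increment \<nu> u) (at u)"
proof -
  have "((\<lambda>u. - (a * u\<^sup>2 / 2)) has_real_derivative - (a * u)) (at u)"
    by (auto intro!: derivative_eq_intros)
  hence "((\<lambda>u. complex_of_real (- (a * u\<^sup>2 / 2))) has_vector_derivative of_real (- (a * u))) (at u)"
    by (rule has_vector_derivative_of_real[unfolded has_real_derivative_iff_has_vector_derivative[symmetric]])
  from has_vector_derivative_add[OF this iexp_excess_deriv[OF sets_\<nu> levy_second_moment]]
  show ?thesis by simp
qed

lemma iexp_increment_0: "iexp_increment N 0 = 0"
  by simp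

text \<open>
  Differentiating \<open>\<phi> = exp \<psi>\<close> gives \<open>\<phi>' = \<phi> \<psi>'\<close>. At the origin the left side is \<open>\<i>\<close> times the mean, so a centered
  law has no drift in the fully compensated form, and the equation at a general point is the second claim.
\<close>

lemma char_exponent: "char \<mu> u = exp (- of_real (a * u\<^sup>2 / 2) + iexp_excess \<nu> u)"
  and iexp_increment_eq: "iexp_increment \<mu> u = char \<mu> u * (\<i> * of_real (a * u) + iexp_increment \<nu> u)"
proof -
  obtain d where d: "\<And>u. char \<mu> u = exp (\<i> * of_real (d * u) + (- of_real (a * u\<^sup>2 / 2) + iexp_excess \<nu> u))"
    using char_exponent_drift by blast
  have eq: "\<i> * iexp_increment \<mu> u = char \<mu> u * (\<i> * of_real d + (- of_real (a * u) + \<i> * iexp_increment \<nu> u))" for u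
  proof (rule vector_derivative_unique_at[OF char_deriv])
    have "((\<lambda>u. \<i> * of_real (d * u)) has_vector_derivative \<i> * of_real d) (at u)"
      by (auto simp: has_vector_derivative_def scaleR_conv_of_real mult_ac intro!: derivative_eq_intros)
    from has_vector_derivative_add[OF this levy_exponent_deriv[of u]]
    have "((\<lambda>u. \<i> * of_real (d * u) + (- of_real (a * u\<^sup>2 / 2) + iexp_excess \<nu> u)) has_vector_derivative
       \<i> * of_real d + (- of_real (a * u) + \<i> * iexp_increment \<nu> u)) (at u)" .
    from field_vector_diff_chain_at[OF this DERIV_exp]
    have "((\<lambda>u. exp (\<i> * of_real (d * u) + (- of_real (a * u\<^sup>2 / 2) + iexp_excess \<nu> u))) has_vector_derivative
       (\<i> * of_real d + (- of_real (a * u) + \<i> * iexp_increment \<nu> u)) *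
        exp (\<i> * of_real (d * u) + (- of_real (a * u\<^sup>2 / 2) + iexp_excess \<nu> u))) (at u)"
      by (simp only: o_def)
    thus "(char \<mu> has_vector_derivative char \<mu> u * (\<i> * of_real d + (- of_real (a * u) + \<i> * iexp_increment \<nu> u))) (at u)"
      unfolding d[symmetric] by (simp add: mult.commute)
  qed
  have "d = 0" using eq[of 0] by (simp add: iexp_increment_0 char_zero)
  thus "char \<mu> u = exp (- of_real (a * u\<^sup>2 / 2) + iexp_excess \<nu> u)" using d by simp
  have "\<i> * iexp_increment \<mu> u = \<i> * (char \<mu> u * (\<i> * of_real (a * u) + iexp_increment \<nu> u))"
    unfolding eq using \<open>d = 0\<close> by (simp add: algebra_simps)
  thus "iexp_increment \<mu> u = char \<mu> u * (\<i> * of_real (a * u) + iexp_increment \<nu> u)" by simp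
qed

text \<open>
  Derivative at the origin of the two sides of \<open>iexp_increment_eq\<close>.
\<close>

lemma variance_decomposition: "V = a + (LINT x|\<nu>. x\<^sup>2)"
proof -
  have sq: "(LINT x|N. of_real (x\<^sup>2) * iexp (0 * x)) = complex_of_real (LINT x|N. x\<^sup>2)" for N :: "real measure"
    by (simp only: mult_zero_left of_real_0 mult_zero_right exp_zero mult_1_right integral_complex_of_real)
  have d: "((\<lambda>u. \<i> * of_real (a * u)) has_vector_derivative \<i> * of_real a) (at 0)"
    by (auto simp: has_vector_derivative_def scaleR_conv_of_real mult_ac intro!: derivative_eq_intros)
  from has_vector_derivative_mult[OF char_deriv[of 0]
    has_vector_derivative_add[OF d iexp_increment_deriv[OF sets_\<nu> levy_second_moment, of 0]]]
  have "((\<lambda>u. char \<mu> u * (\<i> * of_real (a * u) + iexp_increment \<nu> u)) has_vector_derivative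
     \<i> * of_real (a + (LINT x|\<nu>. x\<^sup>2))) (at 0)"
    unfolding sq iexp_increment_0 by (simp add: char_zero algebra_simps del: of_real_power)
  hence "(iexp_increment \<mu> has_vector_derivative \<i> * of_real (a + (LINT x|\<nu>. x\<^sup>2))) (at 0)"
    unfolding iexp_increment_eq[symmetric] .
  moreover have "(iexp_increment \<mu> has_vector_derivative \<i> * of_real (LINT x|\<mu>. x\<^sup>2)) (at 0)"
    using iexp_increment_deriv[OF _ second_moment, of 0] unfolding sq by simp
  ultimately have "\<i> * complex_of_real (a + (LINT x|\<nu>. x\<^sup>2)) = \<i> * of_real (LINT x|\<mu>. x\<^sup>2)"
    by (rule vector_derivative_unique_at)
  thus ?thesis unfolding variance_eq by (simp del: of_real_add)
qed

lemma prob_space_Z: "prob_space (Z_law a \<nu> V)"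
  by (rule prob_space_Z_law[OF sets_\<nu> gaussian_nonneg variance_pos levy_second_moment variance_decomposition])

lemma prob_space_square_bias: "prob_space (Z_law 0 \<mu> V)"
  by (rule prob_space_Z_law) (use variance_pos second_moment variance_eq in auto)

text \<open>
  The zero-bias transform of a centered law \<open>\<mu>\<close> is the law of \<open>U Y\<close> with \<open>U\<close> uniform on \<open>[0,1]\<close> and \<open>Y\<close> an
  independent variable of law \<open>x\<^sup>2 \<mu>(dx) / V\<close>. For a law with a Levy representation it amounts to adding the
  independent variable \<open>U Z\<close>. In terms of characteristic functions this is the differential equation
  \<open>\<phi>' = \<phi> \<psi>'\<close>. As an identity between probability measures, however, it may be integrated against any
  nonnegative function, in particular against exponentials, whether or not they are integrable.
\<close>

lemma zero_bias_convolution: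
  "product_law uniform_01 (Z_law 0 \<mu> V) = (\<mu> \<star> product_law uniform_01 (Z_law a \<nu> V))"
proof (rule Levy_uniqueness)
  note [intro] = prob_space_Z prob_space_square_bias prob_space_uniform_01 real_distribution_axioms
  show L: "real_distribution (product_law uniform_01 (Z_law 0 \<mu> V))"
    by (rule real_distribution_product_law) auto
  have W: "real_distribution (product_law uniform_01 (Z_law a \<nu> V))"
    by (rule real_distribution_product_law) auto
  show R: "real_distribution (\<mu> \<star> product_law uniform_01 (Z_law a \<nu> V))"
    by (rule real_distribution_convolution[OF _ W]) auto
  show "char (product_law uniform_01 (Z_law 0 \<mu> V)) = char (\<mu> \<star> product_law uniform_01 (Z_law a \<nu> V))"
  proof
    fix u
    show "char (product_law uniform_01 (Z_law 0 \<mu> V)) u = char (\<mu> \<star> product_law uniform_01 (Z_law a \<nu> V)) u"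
    proof (cases "u = 0")
      case True
      thus ?thesis using real_distribution.char_zero[OF L] real_distribution.char_zero[OF R] by simp
    next
      case False
      have "\<i> * of_real (u * V) * char (product_law uniform_01 (Z_law 0 \<mu> V)) u = iexp_increment \<mu> u"
        using char_product_law_uniform[of \<mu> 0 V u] variance_pos second_moment variance_eq by simp
      also have "\<dots> = char \<mu> u * (\<i> * of_real (u * V) * char (product_law uniform_01 (Z_law a \<nu> V)) u)"
        unfolding iexp_increment_eq
          char_product_law_uniform[OF sets_\<nu> gaussian_nonneg variance_pos levy_second_moment variance_decomposition] ..
      also have "\<dots> = \<i> * of_real (u * V) * char (\<mu> \<star> product_law uniform_01 (Z_law a \<nu> V)) u"
        by (subst char_convolution[OF _ W]) (auto simp: mult_ac)
      finally show ?thesis using False variance_pos by simp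
    qed
  qed
qed

text \<open>
  Near the origin \<open>Ln \<circ> char \<mu>\<close> is the Levy exponent itself, because the imaginary part of the exponent is
  small there; the three derivatives then pass under the integral.
\<close>

lemma cumulant_3: "cumulant 3 \<mu> = (LINT x|\<nu>. x ^ 3)"
proof -
  define g where "g = (\<lambda>u. - of_real (a * u\<^sup>2 / 2) + iexp_excess \<nu> u)"
  have g: "(g has_vector_derivative - of_real (a * u) + \<i> * iexp_increment \<nu> u) (at u)" for u
    unfolding g_def by (rule levy_exponent_deriv)
  have cont: "continuous_on UNIV (\<lambda>u. Im (g u))"
    by (intro continuous_intros continuous_at_imp_continuous_on ballI has_vector_derivative_continuous[OF g])
  \<comment> \<open>on this open set the principal branch inverts the exponential\<close>
  define S where "S = {u. \<bar>Im (g u)\<bar> < pi}"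
  have S: "open S" unfolding S_def
    by (intro open_Collect_less continuous_intros cont)
  have "g 0 = 0" by (simp add: g_def iexp_excess_def)
  hence "0 \<in> S" by (simp add: S_def)
  let ?D = "\<lambda>f u. vector_derivative f (at u)"
  have L: "Ln (char \<mu> u) = g u" if "u \<in> S" for u
    using that unfolding S_def char_exponent g_def by (intro Ln_exp) auto
  have D1: "?D (\<lambda>u. Ln (char \<mu> u)) u = - of_real (a * u) + \<i> * iexp_increment \<nu> u" if "u \<in> S" for u
    by (rule vector_derivative_eq_on_open[OF S L g that])
  have lin: "((\<lambda>u. - complex_of_real (a * u)) has_vector_derivative - of_real a) (at u)" for u
    by (auto simp: has_vector_derivative_def scaleR_conv_of_real mult_ac intro!: derivative_eq_intros)
  have "((\<lambda>u. - of_real (a * u) + \<i> * iexp_increment \<nu> u) has_vector_derivative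
     - of_real a + \<i> * (\<i> * (LINT x|\<nu>. of_real (x\<^sup>2) * iexp (u * x)))) (at u)" for u
    by (intro has_vector_derivative_add has_vector_derivative_mult_right lin
      iexp_increment_deriv[OF sets_\<nu> levy_second_moment])
  from vector_derivative_eq_on_open[OF S D1 this]
  have D2: "?D (?D (\<lambda>u. Ln (char \<mu> u))) u =
     - of_real a + \<i> * (\<i> * (LINT x|\<nu>. of_real (x\<^sup>2) * iexp (u * x)))" if "u \<in> S" for u
    using that by blast
  have d3: "((\<lambda>u. - of_real a + \<i> * (\<i> * (LINT x|\<nu>. of_real (x\<^sup>2) * iexp (u * x)))) has_vector_derivative
     0 + \<i> * (\<i> * (\<i> * (LINT x|\<nu>. of_real (x ^ 3) * iexp (u * x))))) (at u)" for u
    by (intro has_vector_derivative_add has_vector_derivative_mult_right has_vector_derivative_const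
      iexp_second_moment_deriv[OF sets_\<nu> levy_second_moment levy_third_moment])
  have cube: "(LINT x|\<nu>. of_real (x ^ 3) * iexp (0 * x)) = complex_of_real (LINT x|\<nu>. x ^ 3)"
    by (simp only: mult_zero_left of_real_0 mult_zero_right exp_zero mult_1_right integral_complex_of_real)
  from vector_derivative_eq_on_open[OF S D2 d3 \<open>0 \<in> S\<close>]
  have "?D (?D (?D (\<lambda>u. Ln (char \<mu> u)))) 0 = \<i> ^ 3 * of_real (LINT x|\<nu>. x ^ 3)"
    unfolding cube by (simp add: power3_eq_cube del: of_real_mult of_real_power)
  hence "(?D ^^ 3) (\<lambda>u. Ln (char \<mu> u)) 0 = \<i> ^ 3 * of_real (LINT x|\<nu>. x ^ 3)"
    by (simp add: eval_nat_numeral)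
  thus ?thesis by (simp add: cumulant_def)
qed

end

section \<open>Compensated exponentials\<close>

text \<open>
  The real counterparts of the integrands above: \<open>exp_excess t\<close> is convex and nonnegative in \<open>t\<close>, with
  derivative \<open>exp_increment t\<close>. Convexity supplies its dominating functions.
\<close>

definition exp_excess :: "real \<Rightarrow> real \<Rightarrow> real" where
  "exp_excess t x = exp (t * x) - 1 - t * x"

definition exp_increment :: "real \<Rightarrow> real \<Rightarrow> real" where
  "exp_increment t x = x * (exp (t * x) - 1)"

lemma exp_excess_measurable [measurable]: "exp_excess t \<in> borel_measurable borel"
  and exp_increment_measurable [measurable]: "exp_increment t \<in> borel_measurable borel"
  by (simp_all add: exp_excess_def[abs_def] exp_increment_def[abs_def])

lemma exp_excess_0 [simp]: "exp_excess 0 x = 0"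
  by (simp add: exp_excess_def)

lemma exp_excess_nonneg: "exp_excess t x \<ge> 0"
  unfolding exp_excess_def using exp_ge_add_one_self[of "t * x"] by linarith

lemma exp_excess_deriv: "((\<lambda>s. exp_excess s x) has_real_derivative exp_increment s x) (at s within A)"
  unfolding exp_excess_def exp_increment_def
  by (auto intro!: derivative_eq_intros simp: algebra_simps)

lemma exp_increment_nonneg:
  assumes "t \<ge> 0" shows "exp_increment t x \<ge> 0"
  using assms unfolding exp_increment_def
  by (cases "x \<ge> 0") (auto intro!: mult_nonneg_nonneg mult_nonpos_nonpos simp: mult_nonneg_nonpos)

lemma exp_excess_tangent: "(t - s) * exp_increment s x \<le> exp_excess t x - exp_excess s x"
proof -
  have "exp (s * x) * (1 + (t - s) * x) \<le> exp (s * x) * exp ((t - s) * x)"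
    by (intro mult_left_mono exp_ge_add_one_self) auto
  also have "\<dots> = exp (t * x)" by (simp add: exp_add[symmetric] algebra_simps)
  finally show ?thesis by (simp add: exp_excess_def exp_increment_def algebra_simps)
qed

lemma exp_excess_mono: "0 \<le> s \<Longrightarrow> s \<le> t \<Longrightarrow> exp_excess s x \<le> exp_excess t x"
  using exp_excess_tangent[of t s x] mult_nonneg_nonneg[OF _ exp_increment_nonneg[of s x], of "t - s"]
  by simp

text \<open>
  The slope at \<open>s\<close> is at most the slope at \<open>r\<close>, hence at most the slope of the chord from \<open>r\<close> to \<open>t\<close>. The bound is
  uniform in \<open>s \<le> r\<close> and integrable when \<open>exp_excess t\<close> is, which allows differentiation under the integral to the
  left of \<open>t\<close>.
\<close>

lemma exp_increment_le_excess:
  assumes "0 \<le> s" "s \<le> r" "r < t"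
  shows "exp_increment s x \<le> exp_excess t x / (t - r)"
proof -
  have "(t - r) * exp_increment s x \<le> (t - s) * exp_increment s x"
    using assms exp_increment_nonneg[of s x] by (intro mult_right_mono) auto
  also have "\<dots> \<le> exp_excess t x" using exp_excess_tangent[of t s x] exp_excess_nonneg[of s x] by simp
  finally show ?thesis using assms by (simp add: field_simps)
qed

lemma exp_excess_le_increment: "exp_excess s x \<le> s * exp_increment s x"
  using exp_excess_tangent[of 0 s x] by simp

context
  fixes N :: "real measure" and t :: real
  assumes N [measurable_cong]: "sets N = sets borel" and int: "integrable N (exp_excess t)"
begin

lemma integrable_exp_excess:
  assumes "0 \<le> s" "s \<le> t" shows "integrable N (exp_excess s)"
  by (rule Bochner_Integration.integrable_bound[OF int])
     (simp_all add: exp_excess_mono[OF assms] exp_excess_nonneg)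

lemma integrable_exp_increment:
  assumes "0 \<le> s" "s < t" shows "integrable N (exp_increment s)"
  by (rule Bochner_Integration.integrable_bound[of _ "\<lambda>x. exp_excess t x / (t - s)"])
     (use assms in \<open>simp_all add: int exp_increment_le_excess exp_excess_nonneg exp_increment_nonneg\<close>)

lemma continuous_on_integral_exp_excess: "continuous_on {0..t} (\<lambda>s. LINT x|N. exp_excess s x)"
proof (rule continuous_on_integral_param[OF _ _ _ int])
  show "continuous_on {0..t} (\<lambda>s. exp_excess s x)" for x
    unfolding exp_excess_def by (intro continuous_intros)
  show "norm (exp_excess s x) \<le> exp_excess t x" if "s \<in> {0..t}" for s x
    using that exp_excess_mono[of s t x] exp_excess_nonneg[of s x] by simp
qed simp

lemma integral_exp_excess_deriv:
  assumes "0 < s" "s < t"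
  shows "((\<lambda>s. LINT x|N. exp_excess s x) has_real_derivative (LINT x|N. exp_increment s x)) (at s)"
  unfolding has_real_derivative_iff_has_vector_derivative
proof (rule has_vector_derivative_integral_param[where S="{0<..<(s + t) / 2}" and g="\<lambda>x. exp_excess t x / (t - (s + t) / 2)"])
  fix r x assume r: "r \<in> {0<..<(s + t) / 2}"
  show "norm (exp_increment r x) \<le> exp_excess t x / (t - (s + t) / 2)"
    using r assms exp_increment_le_excess[of r "(s + t) / 2" t x] exp_increment_nonneg[of r x] by auto
qed (use assms int integrable_exp_excess exp_excess_deriv in \<open>auto simp flip: has_real_derivative_iff_has_vector_derivative\<close>)

end

section \<open>The cumulant generating function where it is finite\<close>

text \<open>
  The moment generating function of \<open>U Y\<close>, where \<open>U\<close> is uniform and \<open>Y\<close> has law \<open>(c \<delta>\<^sub>0 + x\<^sup>2 N(dx)) / V\<close>.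
\<close>

lemma nn_integral_zero_bias_exp:
  assumes t: "t > 0" and V: "V > 0" and N: "sets N = sets borel" and P: "prob_space (Z_law c N V)" and c: "c \<ge> 0"
  shows "ennreal (t * V) * (\<integral>\<^sup>+y. ennreal (exp (t * y)) \<partial>product_law uniform_01 (Z_law c N V)) =
    ennreal (c * t) + (\<integral>\<^sup>+x. ennreal (exp_increment t x) \<partial>N)"
proof -
  note [measurable_cong] = N
  interpret U: prob_space uniform_01 by (rule prob_space_uniform_01)
  let ?e = "\<lambda>x. \<integral>\<^sup>+b. ennreal (exp (t * (b * x))) \<partial>uniform_01"
  have "ennreal (t * V) * (\<integral>\<^sup>+y. ennreal (exp (t * y)) \<partial>product_law uniform_01 (Z_law c N V)) =
    ennreal t * (ennreal V * (ennreal (1 / V) * (ennreal c * ?e 0 + (\<integral>\<^sup>+x. ennreal (x\<^sup>2) * ?e x \<partial>N))))"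
    using t V by (subst nn_integral_product_law[OF prob_space_uniform_01 _ P], simp, simp, simp, subst nn_integral_Z_law[OF N])
      (auto simp: ennreal_mult mult.assoc)
  also have "\<dots> = ennreal t * (ennreal c * ?e 0 + (\<integral>\<^sup>+x. ennreal (x\<^sup>2) * ?e x \<partial>N))"
    using V by (simp add: mult.assoc[symmetric] ennreal_mult'[symmetric])
  also have "\<dots> = ennreal (c * t) + (\<integral>\<^sup>+x. ennreal t * (ennreal (x\<^sup>2) * ?e x) \<partial>N)"
    using t c U.emeasure_space_1 by (simp add: distrib_left nn_integral_cmult ennreal_mult mult.commute)
  finally show ?thesis unfolding nn_integral_uniform_01_exp[OF t] exp_increment_def .
qed

context centered_levy
begin

text \<open>
  The right-hand side is the cumulant generating function written with the Levy measure; both sides may be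
  infinite.
\<close>

lemma nn_integral_R_law_exp:
  assumes t: "t > 0"
  shows "ennreal (V * t\<^sup>2 / 2) * mgf (R_law a \<nu> V) (\<lambda>r. r) t =
    ennreal (a * t\<^sup>2 / 2) + (\<integral>\<^sup>+x. ennreal (exp_excess t x) \<partial>\<nu>)"
proof -
  interpret U: prob_space beta_1_2 by (rule prob_space_beta_1_2)
  note V = variance_pos
  let ?e = "\<lambda>x. \<integral>\<^sup>+b. ennreal (exp (t * (b * x))) \<partial>beta_1_2"
  have "ennreal (V * t\<^sup>2 / 2) * mgf (R_law a \<nu> V) (\<lambda>r. r) t =
    ennreal (t\<^sup>2 / 2) * (ennreal V * (ennreal (1 / V) * (ennreal a * ?e 0 + (\<integral>\<^sup>+x. ennreal (x\<^sup>2) * ?e x \<partial>\<nu>))))"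
    unfolding mgf_def R_law_eq_product_law using V
    by (subst nn_integral_product_law[OF prob_space_beta_1_2 _ prob_space_Z], simp, simp, simp, subst nn_integral_Z_law[OF sets_\<nu>])
      (auto simp: ennreal_mult'[symmetric] mult.assoc[symmetric])
  also have "\<dots> = ennreal (t\<^sup>2 / 2) * (ennreal a * ?e 0 + (\<integral>\<^sup>+x. ennreal (x\<^sup>2) * ?e x \<partial>\<nu>))"
    using V by (simp add: mult.assoc[symmetric] ennreal_mult'[symmetric])
  also have "\<dots> = ennreal (a * t\<^sup>2 / 2) + (\<integral>\<^sup>+x. ennreal (t\<^sup>2 / 2) * (ennreal (x\<^sup>2) * ?e x) \<partial>\<nu>)"
    using t gaussian_nonneg U.emeasure_space_1
    by (simp add: distrib_left nn_integral_cmult ennreal_mult'[symmetric] mult.commute)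
  finally show ?thesis unfolding nn_integral_beta_1_2_exp[OF t] exp_excess_def .
qed

text \<open>
  The exponential \<open>e\<^sup>s\<^sup>y\<close> integrated against \<open>zero_bias_convolution\<close>. For a finite moment generating function
  \<open>m\<close> this reads \<open>m' = m G'\<close>, where \<open>G(s) = a s\<^sup>2 / 2 + \<integral> (e\<^sup>s\<^sup>x - 1 - s x) \<nu>(dx)\<close>.
\<close>

lemma zero_bias_identity:
  assumes s: "s > 0"
  shows "(\<integral>\<^sup>+x. ennreal (exp_increment s x) \<partial>\<mu>) =
    (\<integral>\<^sup>+x. ennreal (exp (s * x)) \<partial>\<mu>) * (ennreal (a * s) + (\<integral>\<^sup>+x. ennreal (exp_increment s x) \<partial>\<nu>))"
proof -
  let ?W = "product_law uniform_01 (Z_law a \<nu> V)"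
  interpret W: real_distribution ?W
    by (rule real_distribution_product_law[OF prob_space_uniform_01 _ prob_space_Z]) auto
  have [measurable_cong]: "sets \<mu> = sets borel" by simp
  have "(\<integral>\<^sup>+x. ennreal (exp_increment s x) \<partial>\<mu>) =
     ennreal (s * V) * (\<integral>\<^sup>+y. ennreal (exp (s * y)) \<partial>(\<mu> \<star> ?W))"
    unfolding zero_bias_convolution[symmetric]
    using nn_integral_zero_bias_exp[OF s variance_pos _ prob_space_square_bias] by simp
  also have "(\<integral>\<^sup>+y. ennreal (exp (s * y)) \<partial>(\<mu> \<star> ?W)) =
    (\<integral>\<^sup>+x. \<integral>\<^sup>+y. ennreal (exp (s * x)) * ennreal (exp (s * y)) \<partial>?W \<partial>\<mu>)"
    by (subst nn_integral_convolution)
       (auto simp: distrib_left exp_add ennreal_mult finite_measure_axioms W.finite_measure_axioms)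
  also have "\<dots> = (\<integral>\<^sup>+x. ennreal (exp (s * x)) \<partial>\<mu>) * (\<integral>\<^sup>+y. ennreal (exp (s * y)) \<partial>?W)"
    by (simp add: nn_integral_cmult nn_integral_multc)
  finally show ?thesis
    unfolding nn_integral_zero_bias_exp[OF s variance_pos sets_\<nu> prob_space_Z gaussian_nonneg, symmetric]
    by (simp add: mult_ac)
qed

lemma mgf_finite_iff:
  "(\<integral>\<^sup>+x. ennreal (exp (t * x)) \<partial>\<mu>) < \<infinity> \<longleftrightarrow> integrable \<mu> (exp_excess t)"
proof -
  have [measurable_cong]: "sets \<mu> = sets borel" by simp
  have "(\<integral>\<^sup>+x. ennreal (exp (t * x)) \<partial>\<mu>) < \<infinity> \<longleftrightarrow> integrable \<mu> (\<lambda>x. exp (t * x))"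
    by (simp add: integrable_iff_bounded)
  also have "\<dots> \<longleftrightarrow> integrable \<mu> (exp_excess t)"
  proof
    assume "integrable \<mu> (\<lambda>x. exp (t * x))"
    thus "integrable \<mu> (exp_excess t)" using integrable_first by (simp add: exp_excess_def[abs_def])
  next
    assume "integrable \<mu> (exp_excess t)"
    hence "integrable \<mu> (\<lambda>x. exp_excess t x + (1 + t * x))" using integrable_first by simp
    thus "integrable \<mu> (\<lambda>x. exp (t * x))" by (simp add: exp_excess_def)
  qed
  finally show ?thesis .
qed

lemma mgf_eq:
  assumes "integrable \<mu> (exp_excess t)"
  shows "(\<integral>\<^sup>+x. ennreal (exp (t * x)) \<partial>\<mu>) = ennreal (1 + (LINT x|\<mu>. exp_excess t x))"
proof -
  have "(\<integral>\<^sup>+x. ennreal (exp (t * x)) \<partial>\<mu>) = (\<integral>\<^sup>+x. ennreal (exp_excess t x + (1 + t * x)) \<partial>\<mu>)"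
    by (simp add: exp_excess_def)
  also have "\<dots> = ennreal (LINT x|\<mu>. exp_excess t x + (1 + t * x))"
  proof (rule nn_integral_eq_integral)
    show "integrable \<mu> (\<lambda>x. exp_excess t x + (1 + t * x))" using assms integrable_first by simp
    show "AE x in \<mu>. 0 \<le> exp_excess t x + (1 + t * x)" by (simp add: exp_excess_def)
  qed
  also have "(LINT x|\<mu>. exp_excess t x + (1 + t * x)) = 1 + (LINT x|\<mu>. exp_excess t x)"
    using assms integrable_first mean prob_space[unfolded space_eq_univ]
    by (subst Bochner_Integration.integral_add) simp_all
  finally show ?thesis .
qed

lemma cumulant_ode:
  assumes s: "0 < s" "s < t" and \<mu>: "integrable \<mu> (exp_excess t)" and \<nu>: "integrable \<nu> (exp_excess t)"
  shows "(LINT x|\<mu>. exp_increment s x) =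
     (1 + (LINT x|\<mu>. exp_excess s x)) * (a * s + (LINT x|\<nu>. exp_increment s x))"
proof -
  have i: "integrable \<mu> (exp_increment s)" "integrable \<nu> (exp_increment s)" "integrable \<mu> (exp_excess s)"
    using s integrable_exp_increment[OF _ \<mu>] integrable_exp_increment[OF sets_\<nu> \<nu>] integrable_exp_excess[OF _ \<mu>] by auto
  have nn: "(LINT x|N. exp_increment s x) \<ge> 0" "(LINT x|N. exp_excess s x) \<ge> 0" for N
    using s by (auto intro!: Bochner_Integration.integral_nonneg exp_increment_nonneg exp_excess_nonneg)
  have "ennreal (LINT x|\<mu>. exp_increment s x) =
     ennreal (1 + (LINT x|\<mu>. exp_excess s x)) * (ennreal (a * s) + ennreal (LINT x|\<nu>. exp_increment s x))"
    using zero_bias_identity[OF s(1)] s i unfolding mgf_eq[OF i(3)]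
    by (subst (asm) (1 2) nn_integral_eq_integral) (auto intro!: exp_increment_nonneg)
  also have "\<dots> = ennreal ((1 + (LINT x|\<mu>. exp_excess s x)) * (a * s + (LINT x|\<nu>. exp_increment s x)))"
    using nn gaussian_nonneg s by (subst ennreal_mult) (auto intro!: add_nonneg_nonneg)
  finally show ?thesis
    using nn gaussian_nonneg s by (subst (asm) ennreal_inj) auto
qed

text \<open>
  The logarithm of the moment generating function and \<open>G\<close> have the same derivative on \<open>(0, t)\<close>, both vanish at
  the origin, and both are continuous up to \<open>t\<close>.
\<close>

lemma ln_mgf_eq:
  assumes t: "t > 0" and \<mu>: "integrable \<mu> (exp_excess t)" and \<nu>: "integrable \<nu> (exp_excess t)"
  shows "ln (1 + (LINT x|\<mu>. exp_excess t x)) = a * t\<^sup>2 / 2 + (LINT x|\<nu>. exp_excess t x)"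
proof -
  define h where "h s = ln (1 + (LINT x|\<mu>. exp_excess s x)) - a * s\<^sup>2 / 2 - (LINT x|\<nu>. exp_excess s x)" for s
  have pos: "1 + (LINT x|\<mu>. exp_excess s x) > 0" for s
    by (intro add_pos_nonneg Bochner_Integration.integral_nonneg exp_excess_nonneg) simp
  have "h t = h 0"
  proof (rule DERIV_isconst_end[OF t])
    have "continuous_on {0..t} (\<lambda>s. LINT x|\<mu>. exp_excess s x)" "continuous_on {0..t} (\<lambda>s. LINT x|\<nu>. exp_excess s x)"
      using continuous_on_integral_exp_excess[OF _ \<mu>] continuous_on_integral_exp_excess[OF sets_\<nu> \<nu>] by auto
    moreover have "1 + (LINT x|\<mu>. exp_excess s x) \<noteq> 0" for s using pos[of s] by simp
    ultimately show "continuous_on {0..t} h" unfolding h_def by (intro continuous_intros) auto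
    fix s assume s: "0 < s" "s < t"
    have "(h has_real_derivative (LINT x|\<mu>. exp_increment s x) / (1 + (LINT x|\<mu>. exp_excess s x)) - a * s - (LINT x|\<nu>. exp_increment s x)) (at s)"
      unfolding h_def using pos[of s]
      by (auto intro!: derivative_eq_intros integral_exp_excess_deriv[OF _ \<mu> s] integral_exp_excess_deriv[OF sets_\<nu> \<nu> s])
    thus "(h has_real_derivative 0) (at s)"
      unfolding cumulant_ode[OF s \<mu> \<nu>] using pos[of s] by simp
  qed
  thus ?thesis by (simp add: h_def)
qed

text \<open>
  For \<open>s < t\<close> the left side of \<open>zero_bias_identity\<close> is finite and its first factor on the right is positive, so the
  jump integral at \<open>s\<close> is finite. By \<open>ln_mgf_eq\<close> these integrals stay below the logarithm of the moment generating
  function at \<open>t\<close>, and monotone convergence lets \<open>s\<close> tend to \<open>t\<close>.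
\<close>

lemma mgf_finite_imp_excess:
  assumes t: "t > 0" and \<mu>: "integrable \<mu> (exp_excess t)"
  shows "integrable \<nu> (exp_excess t)"
proof -
  have low: "integrable \<nu> (exp_excess s)" if s: "0 < s" "s < t" for s
  proof -
    have i: "integrable \<mu> (exp_increment s)" using s integrable_exp_increment[OF _ \<mu>] by auto
    hence "(\<integral>\<^sup>+x. ennreal (exp_increment s x) \<partial>\<mu>) < \<infinity>"
      using s by (subst nn_integral_eq_integral) (auto intro!: exp_increment_nonneg)
    moreover have "(\<integral>\<^sup>+x. ennreal (exp (s * x)) \<partial>\<mu>) \<noteq> 0"
      using s integrable_exp_excess[OF _ \<mu>, of s]
      by (subst mgf_eq) (auto simp: ennreal_eq_0_iff not_le intro!: add_pos_nonneg Bochner_Integration.integral_nonneg exp_excess_nonneg)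
    ultimately have "(\<integral>\<^sup>+x. ennreal (exp_increment s x) \<partial>\<nu>) < \<infinity>"
      unfolding zero_bias_identity[OF s(1)] by (auto simp: ennreal_mult_less_top)
    hence "integrable \<nu> (exp_increment s)"
      using s by (auto simp: integrable_iff_bounded exp_increment_nonneg)
    hence "integrable \<nu> (\<lambda>x. s * exp_increment s x)" by simp
    thus ?thesis
      by (rule Bochner_Integration.integrable_bound)
         (use exp_excess_le_increment exp_excess_nonneg in \<open>auto intro!: AE_I2 intro: order.trans[OF _ abs_ge_self]\<close>)
  qed
  define C where "C = ln (1 + (LINT x|\<mu>. exp_excess t x))"
  \<comment> \<open>increases to \<open>t\<close>; the shift by 2 keeps the first term positive\<close>
  define s where "s n = t * (1 - 1 / real (n + 2))" for n
  have s: "0 < s n" "s n < t" for n using t by (auto simp: s_def)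
  have bound: "(\<integral>\<^sup>+x. ennreal (exp_excess (s n) x) \<partial>\<nu>) \<le> ennreal C" for n
  proof -
    have m: "integrable \<mu> (exp_excess (s n))" using integrable_exp_excess[OF _ \<mu>, of "s n"] s[of n] by auto
    have "(LINT x|\<nu>. exp_excess (s n) x) \<le> ln (1 + (LINT x|\<mu>. exp_excess (s n) x))"
      using ln_mgf_eq[OF s(1) m low[OF s]] gaussian_nonneg by simp
    also have "\<dots> \<le> C" unfolding C_def using s[of n]
      by (subst ln_le_cancel_iff)
         (auto intro!: add_pos_nonneg Bochner_Integration.integral_nonneg exp_excess_nonneg integral_mono m \<mu> exp_excess_mono)
    finally show ?thesis using low[OF s]
      by (subst nn_integral_eq_integral) (auto intro!: exp_excess_nonneg ennreal_leI)
  qed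
  have lim: "(\<lambda>n. \<integral>\<^sup>+x. ennreal (exp_excess (s n) x) \<partial>\<nu>) \<longlonglongrightarrow> (\<integral>\<^sup>+x. ennreal (exp_excess t x) \<partial>\<nu>)"
  proof (rule nn_integral_LIMSEQ)
    show "incseq (\<lambda>n x. ennreal (exp_excess (s n) x))"
    proof (intro incseq_SucI le_funI ennreal_leI exp_excess_mono)
      show "0 \<le> s n" for n using s[of n] by simp
      show "s n \<le> s (Suc n)" for n unfolding s_def using t by (intro mult_left_mono) (auto simp: field_simps)
    qed
    have "s \<longlonglongrightarrow> t * (1 - 0)"
      unfolding s_def by (intro tendsto_intros LIMSEQ_ignore_initial_segment lim_1_over_n)
    hence "s \<longlonglongrightarrow> t" by simp
    thus "(\<lambda>n. ennreal (exp_excess (s n) x)) \<longlonglongrightarrow> ennreal (exp_excess t x)" for x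
      unfolding exp_excess_def by (intro tendsto_intros)
  qed simp
  have "(\<integral>\<^sup>+x. ennreal (exp_excess t x) \<partial>\<nu>) \<le> ennreal C"
    by (rule LIMSEQ_le_const2[OF lim]) (use bound in auto)
  thus ?thesis using exp_excess_nonneg
    by (auto simp: integrable_iff_bounded intro: order.strict_trans1)
qed

end

section \<open>Finiteness of the moment generating function\<close>

text \<open>
  A truncated form of \<open>nn_integral_uniform_01_exp\<close>: the integral over \<open>b\<close> stops where \<open>b x\<close> passes \<open>n\<close>.
\<close>

lemma nn_integral_uniform_01_exp_truncated:
  assumes s: "s > 0" and n: "n \<ge> 0"
  shows "ennreal (x * (exp (s * min x n) - 1)) \<le>
    ennreal s * (ennreal (x\<^sup>2) * (\<integral>\<^sup>+b. ennreal (exp (s * (b * x))) * indicator {..n} (b * x) \<partial>uniform_01))"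
proof -
  \<comment> \<open>the largest \<open>b \<le> 1\<close> with \<open>b x \<le> n\<close>\<close>
  define c where "c = (if x \<le> n then 1 else n / x)"
  have c: "0 \<le> c" "c \<le> 1" "c * x = min x n"
    using n by (auto simp: c_def divide_simps)
  have le: "b * x \<le> n" if "0 \<le> b" "b \<le> c" for b
  proof (cases "x \<ge> 0")
    case True
    thus ?thesis using mult_right_mono[OF that(2) True] c(3) by simp
  next
    case False
    thus ?thesis using that n by (smt (verit) mult_nonneg_nonpos)
  qed
  have "ennreal (x * (exp (s * min x n) - 1)) = ennreal (x * exp (s * (c * x)) - x * exp (s * (0 * x)))"
    by (simp add: c algebra_simps)
  also have "\<dots> = (\<integral>\<^sup>+b. ennreal (s * x\<^sup>2 * exp (s * (b * x))) * indicator {0..c} b \<partial>lborel)"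
    using s c by (intro nn_integral_FTC_Icc[symmetric, where F="\<lambda>b. x * exp (s * (b * x))"])
      (auto intro!: derivative_eq_intros simp: power2_eq_square)
  also have "\<dots> \<le> (\<integral>\<^sup>+b. ennreal s * (ennreal (x\<^sup>2) * (ennreal (exp (s * (b * x))) * indicator {..n} (b * x) * indicator {0..1} b)) \<partial>lborel)"
    using s c le by (intro nn_integral_mono) (auto simp: ennreal_mult mult.assoc split: split_indicator)
  also have "\<dots> = ennreal s * (ennreal (x\<^sup>2) * (\<integral>\<^sup>+b. ennreal (exp (s * (b * x))) * indicator {..n} (b * x) \<partial>uniform_01))"
    by (subst nn_integral_uniform_01) (auto simp: nn_integral_cmult)
  finally show ?thesis .
qed

context centered_levy
begin

abbreviation truncated_mgf :: "real \<Rightarrow> real \<Rightarrow> real" where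
  "truncated_mgf n s \<equiv> (LINT x|\<mu>. exp (s * min x n))"

lemma integrable_truncated:
  assumes "s \<ge> 0" shows "integrable \<mu> (\<lambda>x. exp (s * min x n))"
proof (rule integrable_const_bound[where B="exp (s * n)"])
  have "s * min x n \<le> s * n" for x using assms by (intro mult_left_mono) auto
  thus "AE x in \<mu>. norm (exp (s * min x n)) \<le> exp (s * n)" by simp
qed simp

lemma integrable_first_truncated:
  assumes "s \<ge> 0" shows "integrable \<mu> (\<lambda>x. x * exp (s * min x n))"
proof (rule Bochner_Integration.integrable_bound[of _ "\<lambda>x. exp (s * n) * x"])
  show "integrable \<mu> (\<lambda>x. exp (s * n) * x)" using integrable_first by simp
  show "AE x in \<mu>. norm (x * exp (s * min x n)) \<le> norm (exp (s * n) * x)"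
  proof (intro AE_I2)
    fix x :: real
    have "s * min x n \<le> s * n" using assms by (intro mult_left_mono) auto
    hence "exp (s * min x n) \<le> exp (s * n)" by (simp only: exp_le_cancel_iff)
    from mult_right_mono[OF this, of "\<bar>x\<bar>"]
    show "norm (x * exp (s * min x n)) \<le> norm (exp (s * n) * x)"
      by (simp only: real_norm_def abs_mult abs_exp_cancel mult.commute[of "\<bar>x\<bar>"] abs_ge_zero)
  qed
qed simp

text \<open>
  The test function \<open>e\<^sup>s\<^sup>y 1\<^bsub>y \<le> n\<^esub>\<close> in \<open>zero_bias_convolution\<close>. With \<open>X\<close> of law
  \<open>\<mu>\<close> and \<open>W\<close> the independent variable \<open>U Z\<close> added to it, a negative value of \<open>W\<close> may bring \<open>X + W\<close> below \<open>n\<close> although \<open>X > n\<close>; this is why the truncation is \<open>min X n\<close> rather than a restriction to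
  \<open>X \<le> n\<close>, and why \<open>1 + e\<^sup>s\<^sup>W\<close> replaces \<open>e\<^sup>s\<^sup>W\<close>, at the price of the extra term \<open>s V\<close>.
\<close>

lemma truncated_growth_bound:
  assumes s: "s > 0" and n: "n \<ge> 0" and i: "integrable \<nu> (exp_increment s)"
  shows "(LINT x|\<mu>. x * exp (s * min x n)) \<le>
    truncated_mgf n s * (s * V + a * s + (LINT x|\<nu>. exp_increment s x))"
proof -
  let ?W = "product_law uniform_01 (Z_law a \<nu> V)"
  let ?h = "\<lambda>y. ennreal (exp (s * y)) * indicator {..n} y"
  let ?G = "LINT x|\<nu>. exp_increment s x"
  interpret W: real_distribution ?W
    by (rule real_distribution_product_law[OF prob_space_uniform_01 _ prob_space_Z]) auto
  have sets\<mu>: "sets \<mu> = sets borel" by simp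
  note [measurable_cong] = sets\<mu>
  note V = variance_pos
  have G: "?G \<ge> 0" using s by (intro Bochner_Integration.integral_nonneg exp_increment_nonneg) simp
  have pos: "truncated_mgf n s \<ge> 0" by (intro Bochner_Integration.integral_nonneg) simp
  interpret U: prob_space uniform_01 by (rule prob_space_uniform_01)
  have h [measurable]: "?h \<in> borel_measurable borel" by measurable
  have hb [measurable]: "(\<lambda>x. \<integral>\<^sup>+b. ?h (b * x) \<partial>uniform_01) \<in> borel_measurable borel"
    by (rule U.borel_measurable_nn_integral) (unfold split_beta', rule measurable_compose[OF _ h], measurable)
  have zb: "(\<integral>\<^sup>+y. ?h y \<partial>product_law uniform_01 (Z_law 0 \<mu> V)) =
    ennreal (1 / V) * (\<integral>\<^sup>+x. ennreal (x\<^sup>2) * (\<integral>\<^sup>+b. ?h (b * x) \<partial>uniform_01) \<partial>\<mu>)"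
    unfolding nn_integral_product_law[OF prob_space_uniform_01 sets_uniform_01 prob_space_square_bias sets_Z_law h]
    by (subst nn_integral_Z_law[OF sets\<mu> hb]) simp
  have ptw: "x * (exp (s * min x n) - 1) \<ge> 0" for x
    using s n by (cases "x \<ge> 0") (auto intro!: mult_nonneg_nonneg mult_nonpos_nonpos simp: mult_nonneg_nonpos min_def)
  have int1: "integrable \<mu> (\<lambda>x. x * (exp (s * min x n) - 1))"
    using integrable_first_truncated[of s n] integrable_first s by (simp add: algebra_simps)
  have h_le: "(\<integral>\<^sup>+y. ?h y \<partial>product_law uniform_01 (Z_law 0 \<mu> V)) \<le>
    ennreal (truncated_mgf n s) * (1 + (\<integral>\<^sup>+y. ennreal (exp (s * y)) \<partial>?W))"
  proof -
    have "(\<integral>\<^sup>+y. ?h y \<partial>product_law uniform_01 (Z_law 0 \<mu> V)) = (\<integral>\<^sup>+x. \<integral>\<^sup>+y. ?h (x + y) \<partial>?W \<partial>\<mu>)"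
      unfolding zero_bias_convolution
      by (subst nn_integral_convolution) (auto simp: finite_measure_axioms W.finite_measure_axioms)
    also have "\<dots> \<le> (\<integral>\<^sup>+x. \<integral>\<^sup>+y. ennreal (exp (s * min x n)) * (1 + ennreal (exp (s * y))) \<partial>?W \<partial>\<mu>)"
    proof (intro nn_integral_mono)
      fix x y :: real
      have "exp (s * (x + y)) \<le> exp (s * min x n) * (1 + exp (s * y))" if "x + y \<le> n"
      proof (cases "x \<le> n")
        case True
        thus ?thesis by (simp add: min_def exp_add distrib_left)
      next
        case False
        hence "exp (s * (x + y)) \<le> exp (s * n)" using s that by simp
        thus ?thesis using False by (simp add: min_def distrib_left add_increasing2)
      qed
      thus "?h (x + y) \<le> ennreal (exp (s * min x n)) * (1 + ennreal (exp (s * y)))"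
        by (auto simp: ennreal_mult'[symmetric] ennreal_plus[symmetric] ennreal_1[symmetric]
          split: split_indicator simp del: ennreal_plus ennreal_1)
    qed
    also have "\<dots> = (\<integral>\<^sup>+x. ennreal (exp (s * min x n)) \<partial>\<mu>) * (1 + (\<integral>\<^sup>+y. ennreal (exp (s * y)) \<partial>?W))"
      by (simp add: nn_integral_cmult nn_integral_multc nn_integral_add W.emeasure_space_1[unfolded W.space_eq_univ])
    also have "(\<integral>\<^sup>+x. ennreal (exp (s * min x n)) \<partial>\<mu>) = ennreal (truncated_mgf n s)"
      using s by (intro nn_integral_eq_integral integrable_truncated) auto
    finally show ?thesis .
  qed
  have "ennreal (LINT x|\<mu>. x * (exp (s * min x n) - 1)) = (\<integral>\<^sup>+x. ennreal (x * (exp (s * min x n) - 1)) \<partial>\<mu>)"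
    using int1 ptw by (intro nn_integral_eq_integral[symmetric]) auto
  also have "\<dots> \<le> (\<integral>\<^sup>+x. ennreal s * (ennreal (x\<^sup>2) * (\<integral>\<^sup>+b. ?h (b * x) \<partial>uniform_01)) \<partial>\<mu>)"
    by (intro nn_integral_mono nn_integral_uniform_01_exp_truncated s n)
  also have "\<dots> = ennreal s * (\<integral>\<^sup>+x. ennreal (x\<^sup>2) * (\<integral>\<^sup>+b. ?h (b * x) \<partial>uniform_01) \<partial>\<mu>)"
    by (rule nn_integral_cmult) measurable
  also have "\<dots> = ennreal (s * V) * (\<integral>\<^sup>+y. ?h y \<partial>product_law uniform_01 (Z_law 0 \<mu> V))"
    unfolding zb using s V by (simp add: mult.assoc[symmetric] ennreal_mult'[symmetric])
  also have "\<dots> \<le> ennreal (s * V) * (ennreal (truncated_mgf n s) * (1 + (\<integral>\<^sup>+y. ennreal (exp (s * y)) \<partial>?W)))"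
    by (intro mult_left_mono h_le) simp
  also have "\<dots> =
    ennreal (truncated_mgf n s) * (ennreal (s * V) + ennreal (s * V) * (\<integral>\<^sup>+y. ennreal (exp (s * y)) \<partial>?W))"
    by (simp only: distrib_left mult_1_right mult_1_left mult_ac)
  also have "\<dots> = ennreal (truncated_mgf n s) * (ennreal (s * V) + (ennreal (a * s) + ennreal ?G))"
    unfolding nn_integral_zero_bias_exp[OF s V sets_\<nu> prob_space_Z gaussian_nonneg]
    using i s by (subst nn_integral_eq_integral) (auto intro!: exp_increment_nonneg)
  also have "\<dots> = ennreal (truncated_mgf n s * (s * V + a * s + ?G))"
    using s V G gaussian_nonneg pos
    by (subst ennreal_mult) (auto simp: add.assoc)
  finally have "(LINT x|\<mu>. x * (exp (s * min x n) - 1)) \<le> truncated_mgf n s * (s * V + a * s + ?G)"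
    using s V G gaussian_nonneg pos by (subst (asm) ennreal_le_iff) auto
  moreover have "(LINT x|\<mu>. x * (exp (s * min x n) - 1)) = (LINT x|\<mu>. x * exp (s * min x n))"
    using integrable_first_truncated[of s n] integrable_first s mean by (simp add: algebra_simps)
  ultimately show ?thesis by simp
qed

lemma truncated_mgf_deriv:
  assumes s: "0 < s"
  shows "(truncated_mgf n has_real_derivative (LINT x|\<mu>. min x n * exp (s * min x n))) (at s)"
  unfolding has_real_derivative_iff_has_vector_derivative
proof (rule has_vector_derivative_integral_param[where S="{0<..<s + 1}" and g="\<lambda>x. (\<bar>x\<bar> + \<bar>n\<bar>) * exp ((s + 1) * \<bar>n\<bar>)"])
  fix r x assume r: "r \<in> {0<..<s + 1}"
  have "r * min x n \<le> (s + 1) * \<bar>n\<bar>"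
    using r by (intro order.trans[OF mult_left_mono[of "min x n" "\<bar>n\<bar>" r]] mult_right_mono) auto
  thus "norm (min x n * exp (r * min x n)) \<le> (\<bar>x\<bar> + \<bar>n\<bar>) * exp ((s + 1) * \<bar>n\<bar>)"
    by (auto simp: abs_mult intro!: mult_mono)
  show "((\<lambda>r. exp (r * min x n)) has_vector_derivative min x n * exp (r * min x n)) (at r)"
    unfolding has_real_derivative_iff_has_vector_derivative[symmetric]
    by (auto intro!: derivative_eq_intros)
next
  fix r assume "r \<in> {0<..<s + 1}"
  thus "integrable \<mu> (\<lambda>x. exp (r * min x n))" by (intro integrable_truncated) simp
next
  show "integrable \<mu> (\<lambda>x. (\<bar>x\<bar> + \<bar>n\<bar>) * exp ((s + 1) * \<bar>n\<bar>))"
    by (intro integrable_mult_left Bochner_Integration.integrable_add integrable_abs integrable_first) simp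
qed (use s in simp_all)

lemma truncated_mgf_continuous: "continuous_on {0..t} (truncated_mgf n)"
proof (rule continuous_on_integral_param[where g="\<lambda>_. exp (t * \<bar>n\<bar>)"])
  fix s x assume s: "s \<in> {0..t}"
  have "s * min x n \<le> t * \<bar>n\<bar>"
    using s by (intro order.trans[OF mult_left_mono[of "min x n" "\<bar>n\<bar>" s]] mult_right_mono) auto
  thus "norm (exp (s * min x n)) \<le> exp (t * \<bar>n\<bar>)" by simp
next
  show "continuous_on {0..t} (\<lambda>s. exp (s * min x n))" for x
    by (intro continuous_intros)
qed simp_all

lemma truncated_mgf_pos: "s \<ge> 0 \<Longrightarrow> truncated_mgf n s > 0"
  by (rule expectation_greater) (auto intro: integrable_truncated)

text \<open>
  A Gronwall argument: the logarithmic derivative of the truncated moment generating function is at most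
  \<open>V s + G'(s)\<close>, by the preceding bound, so the truncated function is bounded independently of \<open>n\<close>.
\<close>

lemma truncated_mgf_bound:
  assumes t: "t > 0" and n: "n \<ge> 0" and \<nu>: "integrable \<nu> (exp_excess t)"
  shows "truncated_mgf n t \<le> exp ((V + a) * t\<^sup>2 / 2 + (LINT x|\<nu>. exp_excess t x))"
proof -
  define h where "h s = ln (truncated_mgf n s) - (V + a) * s\<^sup>2 / 2 - (LINT x|\<nu>. exp_excess s x)" for s
  have "h t \<le> h 0"
  proof (rule DERIV_nonpos_imp_decreasing_open[of 0 t h])
    have "truncated_mgf n s \<noteq> 0" if "s \<in> {0..t}" for s using truncated_mgf_pos[of s n] that by simp
    thus "continuous_on {0..t} h" unfolding h_def
      by (intro continuous_intros truncated_mgf_continuous continuous_on_integral_exp_excess[OF sets_\<nu> \<nu>]) auto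
    fix s assume s: "0 < s" "s < t"
    let ?D = "LINT x|\<mu>. min x n * exp (s * min x n)"
    let ?G = "LINT x|\<nu>. exp_increment s x"
    have pos: "truncated_mgf n s > 0" using s by (intro truncated_mgf_pos) simp
    have "(h has_real_derivative ?D / truncated_mgf n s - (V + a) * s - ?G) (at s)"
      unfolding h_def using pos
      by (auto intro!: derivative_eq_intros truncated_mgf_deriv[OF s(1)] integral_exp_excess_deriv[OF sets_\<nu> \<nu> s])
    moreover have "?D \<le> (LINT x|\<mu>. x * exp (s * min x n))"
    proof (rule integral_mono)
      show first: "integrable \<mu> (\<lambda>x. x * exp (s * min x n))" using s by (intro integrable_first_truncated) simp
      show "integrable \<mu> (\<lambda>x. min x n * exp (s * min x n))"
      proof (rule Bochner_Integration.integrable_bound)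
        show "integrable \<mu> (\<lambda>x. \<bar>x * exp (s * min x n)\<bar> + \<bar>n * exp (s * min x n)\<bar>)"
          using first integrable_truncated[of s n] s by (intro Bochner_Integration.integrable_add integrable_abs) auto
      qed (auto simp: min_def intro!: AE_I2)
    qed (auto intro!: mult_right_mono)
    hence "?D \<le> truncated_mgf n s * (s * V + a * s + ?G)"
      using truncated_growth_bound[OF s(1) n integrable_exp_increment[OF sets_\<nu> \<nu> _ s(2)]] s by simp
    hence "?D / truncated_mgf n s - (V + a) * s - ?G \<le> 0"
      using pos by (simp add: field_simps)
    ultimately show "\<exists>y. (h has_real_derivative y) (at s) \<and> y \<le> 0" by blast
  qed (use t in simp)
  hence "ln (truncated_mgf n t) \<le> (V + a) * t\<^sup>2 / 2 + (LINT x|\<nu>. exp_excess t x)"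
    by (simp add: h_def prob_space[unfolded space_eq_univ])
  thus ?thesis using truncated_mgf_pos[of t n] t by (metis exp_le_cancel_iff exp_ln less_imp_le)
qed

text \<open>
  The identity \<open>m' = m G'\<close> holds trivially when \<open>m = \<infinity>\<close>, so it cannot rule out that \<open>m\<close> becomes infinite while \<open>G\<close> is
  still finite. The uniform bound on the truncated functions does.
\<close>

lemma excess_imp_mgf_finite:
  assumes t: "t > 0" and \<nu>: "integrable \<nu> (exp_excess t)"
  shows "integrable \<mu> (exp_excess t)"
proof -
  define C where "C = exp ((V + a) * t\<^sup>2 / 2 + (LINT x|\<nu>. exp_excess t x))"
  have [measurable_cong]: "sets \<mu> = sets borel" by simp
  have lim: "(\<lambda>k. \<integral>\<^sup>+x. ennreal (exp (t * min x (real k))) \<partial>\<mu>) \<longlonglongrightarrow> (\<integral>\<^sup>+x. ennreal (exp (t * x)) \<partial>\<mu>)"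
  proof (rule nn_integral_LIMSEQ)
    show "incseq (\<lambda>k x. ennreal (exp (t * min x (real k))))"
      using t by (intro incseq_SucI le_funI ennreal_leI) auto
    show "(\<lambda>k. ennreal (exp (t * min x (real k)))) \<longlonglongrightarrow> ennreal (exp (t * x))" for x
    proof (rule tendsto_eventually)
      obtain k0 where "x \<le> real k0" using real_arch_simple by blast
      thus "\<forall>\<^sub>F k in sequentially. ennreal (exp (t * min x (real k))) = ennreal (exp (t * x))"
        by (intro eventually_sequentiallyI[of k0]) (auto simp: min_def)
    qed
  qed simp
  have "(\<integral>\<^sup>+x. ennreal (exp (t * x)) \<partial>\<mu>) \<le> ennreal C"
  proof (rule LIMSEQ_le_const2[OF lim], intro exI allI impI)
    fix k :: nat
    have "(\<integral>\<^sup>+x. ennreal (exp (t * min x (real k))) \<partial>\<mu>) = ennreal (truncated_mgf k t)"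
      using t by (intro nn_integral_eq_integral integrable_truncated) auto
    also have "\<dots> \<le> ennreal C" unfolding C_def
      by (intro ennreal_leI truncated_mgf_bound t \<nu>) simp
    finally show "(\<integral>\<^sup>+x. ennreal (exp (t * min x (real k))) \<partial>\<mu>) \<le> ennreal C" .
  qed
  hence "(\<integral>\<^sup>+x. ennreal (exp (t * x)) \<partial>\<mu>) < \<infinity>"
    by (rule order.strict_trans1) simp
  thus ?thesis by (simp only: mgf_finite_iff)
qed

text \<open>
  The representation \<open>K(t) = (V t\<^sup>2 / 2) M\<^sub>R(t)\<close>, including the case that both sides are infinite.
\<close>

lemma cgf_eq_mgf_R:
  assumes t: "t > 0"
  shows "cgf \<mu> (\<lambda>x. x) t = enn2ereal (ennreal (V * t\<^sup>2 / 2) * mgf (R_law a \<nu> V) (\<lambda>r. r) t)"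
proof (cases "integrable \<nu> (exp_excess t)")
  case True
  note \<mu> = excess_imp_mgf_finite[OF t True]
  have nn: "(LINT x|N. exp_excess t x) \<ge> 0" for N by (intro Bochner_Integration.integral_nonneg exp_excess_nonneg)
  have "cgf \<mu> (\<lambda>x. x) t = ereal (a * t\<^sup>2 / 2 + (LINT x|\<nu>. exp_excess t x))"
    unfolding cgf_def mgf_def mgf_eq[OF \<mu>] ln_mgf_eq[OF t \<mu> True, symmetric] using nn[of \<mu>]
    by (simp del: ennreal_plus)
  also have "\<dots> = enn2ereal (ennreal (a * t\<^sup>2 / 2) + (\<integral>\<^sup>+x. ennreal (exp_excess t x) \<partial>\<nu>))"
    using nn[of \<nu>] gaussian_nonneg
    by (subst nn_integral_eq_integral[OF True]) (auto simp: exp_excess_nonneg ennreal_plus[symmetric] simp del: ennreal_plus)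
  finally show ?thesis unfolding nn_integral_R_law_exp[OF t] .
next
  case False
  hence "\<not> integrable \<mu> (exp_excess t)" using mgf_finite_imp_excess[OF t] by blast
  hence "cgf \<mu> (\<lambda>x. x) t = \<infinity>"
    unfolding mgf_finite_iff[symmetric] cgf_def mgf_def by (simp add: top.not_eq_extremum)
  moreover have "(\<integral>\<^sup>+x. ennreal (exp_excess t x) \<partial>\<nu>) = \<infinity>"
    using False by (simp add: integrable_iff_bounded exp_excess_nonneg less_top[symmetric])
  ultimately show ?thesis unfolding nn_integral_R_law_exp[OF t] by simp
qed

end

section \<open>Moment generating functions near the origin\<close>

text \<open>
  A convex function vanishing at the origin has increasing chord slopes. This dominates the difference
  quotients of the moment generating function at the origin.
\<close>

lemma exp_excess_divide_mono:
  assumes "0 < s" "s \<le> t" shows "exp_excess s x / s \<le> exp_excess t x / t"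
proof -
  have "(t - s) * exp_excess s x \<le> (t - s) * (s * exp_increment s x)"
    using assms exp_excess_le_increment[of s x] by (intro mult_left_mono) auto
  also have "\<dots> \<le> s * (exp_excess t x - exp_excess s x)"
    using exp_excess_tangent[of t s x] assms mult_left_mono[of "(t - s) * exp_increment s x" "exp_excess t x - exp_excess s x" s]
    by (simp add: algebra_simps)
  finally show ?thesis using assms by (simp add: field_simps)
qed

lemma exp_excess_divide_tendsto: "((\<lambda>s. exp_excess s x / s) \<longlongrightarrow> 0) (at_right 0)"
proof -
  have "((\<lambda>s. exp_excess s x) has_real_derivative exp_increment 0 x) (at 0 within {0<..})"
    by (rule exp_excess_deriv)
  thus ?thesis by (simp add: has_field_derivative_iff exp_increment_def)
qed

context
  fixes R :: "real measure" and t0 :: real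
  assumes R: "real_distribution R" and first: "integrable R (\<lambda>r. r)"
    and t0: "t0 > 0" and fin: "mgf R (\<lambda>r. r) t0 < \<infinity>"
begin

interpretation R: real_distribution R by (rule R)

lemma integrable_exp_below:
  assumes "0 \<le> s" "s \<le> t0" shows "integrable R (\<lambda>r. exp (s * r))"
proof (rule Bochner_Integration.integrable_bound)
  have "integrable R (\<lambda>r. exp (t0 * r))"
    using fin by (simp add: mgf_def integrable_iff_bounded)
  thus "integrable R (\<lambda>r. 1 + exp (t0 * r))" by simp
  have "exp (s * r) \<le> 1 + exp (t0 * r)" for r
  proof (cases "r \<ge> 0")
    case True
    hence "exp (s * r) \<le> exp (t0 * r)" using assms by (simp add: mult_right_mono)
    thus ?thesis by linarith
  next
    case False
    hence "exp (s * r) \<le> 1" using assms by (simp add: mult_nonneg_nonpos)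
    thus ?thesis by (simp add: add_increasing2)
  qed
  thus "AE r in R. norm (exp (s * r)) \<le> norm (1 + exp (t0 * r))" by (intro AE_I2) simp
qed simp

lemma mgf_eq_integral:
  assumes "0 \<le> s" "s \<le> t0" shows "mgf R (\<lambda>r. r) s = ennreal (LINT r|R. exp (s * r))"
  unfolding mgf_def using integrable_exp_below[OF assms] by (intro nn_integral_eq_integral) auto

lemma integral_exp_pos:
  assumes "0 \<le> s" "s \<le> t0" shows "(LINT r|R. exp (s * r)) > 0"
  by (rule R.expectation_greater[OF integrable_exp_below[OF assms]]) simp

lemma integrable_exp_excess_R: "integrable R (exp_excess t0)"
  using integrable_exp_below[of t0] first t0 by (simp add: exp_excess_def[abs_def])

lemma integral_exp_eq:
  assumes "0 \<le> s" "s \<le> t0"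
  shows "(LINT r|R. exp (s * r)) = 1 + s * (LINT r|R. r) + (LINT r|R. exp_excess s r)"
proof -
  have "integrable R (exp_excess s)"
    using integrable_exp_excess[OF _ integrable_exp_excess_R assms] by simp
  hence "(LINT r|R. exp_excess s r + (1 + s * r)) = 1 + s * (LINT r|R. r) + (LINT r|R. exp_excess s r)"
    using first by (simp add: R.prob_space[unfolded R.space_eq_univ])
  thus ?thesis by (simp add: exp_excess_def)
qed

lemma continuous_on_integral_exp: "continuous_on {0..t0} (\<lambda>s. LINT r|R. exp (s * r))"
proof -
  have "continuous_on {0..t0} (\<lambda>s. 1 + s * (LINT r|R. r) + (LINT r|R. exp_excess s r))"
    by (intro continuous_intros continuous_on_integral_exp_excess integrable_exp_excess_R) simp
  thus ?thesis by (rule continuous_on_eq) (simp add: integral_exp_eq)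
qed

lemma integral_exp_tendsto_1: "((\<lambda>s. LINT r|R. exp (s * r)) \<longlongrightarrow> 1) (at_right 0)"
proof -
  have "((\<lambda>s. LINT r|R. exp (s * r)) \<longlongrightarrow> (LINT r|R. exp (0 * r))) (at 0 within {0..t0})"
    using continuous_on_integral_exp[unfolded continuous_on_def, rule_format, of 0] t0 by simp
  thus ?thesis using t0 by (simp add: at_within_Icc_at_right R.prob_space[unfolded R.space_eq_univ])
qed

lemma integral_exp_difference_quotient:
  "((\<lambda>s. ((LINT r|R. exp (s * r)) - 1) / s) \<longlongrightarrow> (LINT r|R. r)) (at_right 0)"
proof -
  have *: "at_right 0 = at 0 within {0<..<t0}"
    using t0 by (intro at_within_nhd[of _ "{..<t0}"]) auto
  have "((\<lambda>s. LINT r|R. exp_excess s r / s) \<longlongrightarrow> (LINT r|R. 0)) (at 0 within {0<..<t0})"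
  proof (rule tendsto_integral_param[where g="\<lambda>r. exp_excess t0 r / t0"])
    show "((\<lambda>s. exp_excess s r / s) \<longlongrightarrow> 0) (at 0 within {0<..<t0})" for r
      using exp_excess_divide_tendsto[of r] unfolding * .
    show "norm (exp_excess s r / s) \<le> exp_excess t0 r / t0" if "s \<in> {0<..<t0}" for s r
      using that exp_excess_divide_mono[of s t0 r] exp_excess_nonneg[of s r] by simp
  qed (use integrable_exp_excess_R in simp_all)
  hence "((\<lambda>s. (LINT r|R. r) + (LINT r|R. exp_excess s r / s)) \<longlongrightarrow> (LINT r|R. r) + (LINT r|R. 0)) (at_right 0)"
    unfolding * by (intro tendsto_add tendsto_const)
  hence lim: "((\<lambda>s. (LINT r|R. r) + (LINT r|R. exp_excess s r / s)) \<longlongrightarrow> (LINT r|R. r)) (at_right 0)"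
    by simp
  show ?thesis
  proof (rule Lim_transform_eventually[OF lim])
    show "\<forall>\<^sub>F s in at_right 0. (LINT r|R. r) + (LINT r|R. exp_excess s r / s) = ((LINT r|R. exp (s * r)) - 1) / s"
      using eventually_at_right_less[of 0] eventually_at_right_real[OF t0]
      by eventually_elim (simp add: integral_exp_eq field_simps)
  qed
qed

end

section \<open>The law of R and the function Psi\<close>

lemma nn_integral_beta_1_2_id: "(\<integral>\<^sup>+b. ennreal b \<partial>beta_1_2) = ennreal (1 / 3)"
proof -
  have "(\<integral>\<^sup>+b. ennreal b \<partial>beta_1_2) = (\<integral>\<^sup>+b. ennreal (2 * (1 - b) * b) * indicator {0..1} b \<partial>lborel)"
    by (subst nn_integral_beta_1_2) (auto intro!: nn_integral_cong simp: ennreal_mult split: split_indicator)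
  also have "\<dots> = ennreal ((1\<^sup>2 - 2 / 3 * 1 ^ 3) - (0\<^sup>2 - 2 / 3 * 0 ^ 3))"
    by (intro nn_integral_FTC_Icc[where F="\<lambda>b. b\<^sup>2 - 2 / 3 * b ^ 3"])
       (auto intro!: derivative_eq_intros simp: algebra_simps power2_eq_square mult_left_le)
  finally show ?thesis by simp
qed

lemma integrable_beta_1_2_id: "integrable beta_1_2 (\<lambda>b. b)"
  and integral_beta_1_2_id: "(LINT b|beta_1_2. b) = 1 / 3"
proof -
  have nn: "AE b in beta_1_2. 0 \<le> b"
    unfolding beta_1_2_def by (subst AE_density) (auto simp: indicator_def)
  show "integrable beta_1_2 (\<lambda>b. b)"
    by (rule integrableI_nonneg) (use nn in \<open>auto simp: nn_integral_beta_1_2_id\<close>)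
  show "(LINT b|beta_1_2. b) = 1 / 3"
    by (subst integral_eq_nn_integral) (use nn in \<open>auto simp: nn_integral_beta_1_2_id\<close>)
qed

context centered_levy
begin

abbreviation R_dist :: "real measure" where "R_dist \<equiv> R_law a \<nu> V"

lemma real_distribution_R: "real_distribution R_dist"
  unfolding R_law_eq_product_law
  by (rule real_distribution_product_law[OF prob_space_beta_1_2 sets_beta_1_2 prob_space_Z sets_Z_law])

text \<open>
  Here \<open>E R = E B E Z\<close>, with \<open>E B = 1/3\<close> and \<open>V E Z = \<integral> x\<^sup>3 \<nu>(dx) = \<kappa>\<^sub>3\<close>.
\<close>

lemma
  shows integrable_R: "integrable R_dist (\<lambda>r. r)"
    and integral_R: "(LINT r|R_dist. r) = cumulant 3 \<mu> / (3 * V)"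
proof -
  note mix = prob_space_beta_1_2 sets_beta_1_2 prob_space_Z sets_Z_law
  have cube: "integrable \<nu> (\<lambda>x. x\<^sup>2 *\<^sub>R x)"
    using levy_third_moment by (simp add: power3_eq_cube power2_eq_square)
  note Z = integral_Z_law[OF sets_\<nu> gaussian_nonneg variance_pos _ cube, simplified]
  have "(\<integral>\<^sup>+r. ennreal (norm r) \<partial>R_dist) = (\<integral>\<^sup>+z. \<integral>\<^sup>+b. ennreal \<bar>b\<bar> * ennreal \<bar>z\<bar> \<partial>beta_1_2 \<partial>Z_law a \<nu> V)"
    unfolding R_law_eq_product_law by (subst nn_integral_product_law[OF mix]) (simp_all add: abs_mult ennreal_mult)
  also have "\<dots> = (\<integral>\<^sup>+b. ennreal \<bar>b\<bar> \<partial>beta_1_2) * (\<integral>\<^sup>+z. ennreal \<bar>z\<bar> \<partial>Z_law a \<nu> V)"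
    by (simp add: nn_integral_multc nn_integral_cmult cong: measurable_cong_sets)
  also have "\<dots> < \<infinity>"
  proof -
    have "(\<integral>\<^sup>+b. ennreal \<bar>b\<bar> \<partial>beta_1_2) < \<infinity>"
      using integrable_beta_1_2_id by (simp add: integrable_iff_bounded)
    moreover have "(\<integral>\<^sup>+z. ennreal \<bar>z\<bar> \<partial>Z_law a \<nu> V) < \<infinity>"
      using Z(1) by (simp add: integrable_iff_bounded)
    ultimately show ?thesis by (simp add: ennreal_mult_less_top)
  qed
  finally show i: "integrable R_dist (\<lambda>r. r)"
    by (simp add: integrable_iff_bounded R_law_eq_product_law cong: measurable_cong_sets)
  have "(LINT r|R_dist. r) = (LINT z|Z_law a \<nu> V. LINT b|beta_1_2. b * z)"
    using i unfolding R_law_eq_product_law by (rule integral_product_law[OF mix])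
  also have "\<dots> = 1 / 3 * (LINT z|Z_law a \<nu> V. z)"
    by (simp add: integral_beta_1_2_id)
  also have "(LINT z|Z_law a \<nu> V. z) = cumulant 3 \<mu> / V"
    using Z(2) variance_pos by (simp add: cumulant_3 field_simps power3_eq_cube power2_eq_square)
  finally show "(LINT r|R_dist. r) = cumulant 3 \<mu> / (3 * V)" by simp
qed

lemma Psi_infinite:
  assumes "mgf R_dist (\<lambda>r. r) t = \<infinity>" shows "Psi a \<nu> V \<theta> t = 1 / t"
  using assms by (simp add: Psi_def)

lemma Psi_finite:
  assumes "mgf R_dist (\<lambda>r. r) t0 < \<infinity>" "0 < t" "t \<le> t0" "\<theta> \<ge> 0"
  shows "Psi a \<nu> V \<theta> t = (1 - \<theta> / (LINT r|R_dist. exp (t * r))) / t"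
proof -
  have "t0 > 0" using assms by simp
  note fin = real_distribution_R integrable_R this assms(1)
  show ?thesis
    unfolding Psi_def using assms integral_exp_pos[OF fin, of t]
    by (subst mgf_eq_integral[OF fin]) (auto simp: divide_ennreal)
qed

lemma Psi_le:
  assumes "t > 0" "\<theta> \<ge> 0" shows "Psi a \<nu> V \<theta> t \<le> 1 / t"
  using assms unfolding Psi_def by (intro mult_left_le) auto

context
  fixes t0 :: real
  assumes t0: "t0 > 0" and fin: "mgf R_dist (\<lambda>r. r) t0 < \<infinity>"
begin

lemmas R_fin = real_distribution_R integrable_R t0 fin

lemma Psi_1_tendsto: "(Psi a \<nu> V 1 \<longlongrightarrow> (LINT r|R_dist. r)) (at_right 0)"
proof -
  let ?M = "\<lambda>t. LINT r|R_dist. exp (t * r)"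
  have "((\<lambda>t. ((?M t - 1) / t) / ?M t) \<longlongrightarrow> (LINT r|R_dist. r) / 1) (at_right 0)"
    by (intro tendsto_divide integral_exp_difference_quotient[OF R_fin] integral_exp_tendsto_1[OF R_fin]) simp
  moreover have "\<forall>\<^sub>F t in at_right 0. ((?M t - 1) / t) / ?M t = Psi a \<nu> V 1 t"
    using eventually_at_right_less[of 0] eventually_at_right_real[OF t0]
  proof eventually_elim
    case (elim t)
    thus ?case using Psi_finite[OF fin, of t 1] integral_exp_pos[OF R_fin, of t] by (simp add: field_simps)
  qed
  ultimately show ?thesis by (simp add: Lim_transform_eventually)
qed

lemma Psi_at_bot:
  assumes "\<theta> > 1" shows "filterlim (Psi a \<nu> V \<theta>) at_bot (at_right 0)"
proof -
  let ?M = "\<lambda>t. LINT r|R_dist. exp (t * r)"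
  have "((\<lambda>t. 1 - \<theta> / ?M t) \<longlongrightarrow> 1 - \<theta> / 1) (at_right 0)"
    by (intro tendsto_intros integral_exp_tendsto_1[OF R_fin]) simp
  hence "filterlim (\<lambda>t. (1 - \<theta> / ?M t) * inverse t) at_bot (at_right 0)"
    using assms by (intro filterlim_tendsto_neg_mult_at_bot[where c="1 - \<theta>"] filterlim_inverse_at_top_right) auto
  moreover have "\<forall>\<^sub>F t in at_right 0. Psi a \<nu> V \<theta> t = (1 - \<theta> / ?M t) * inverse t"
    using eventually_at_right_less[of 0] eventually_at_right_real[OF t0]
  proof eventually_elim
    case (elim t)
    thus ?case using Psi_finite[OF fin, of t \<theta>] assms by (simp add: field_simps)
  qed
  ultimately show ?thesis by (simp cong: filterlim_cong)
qed

lemma Psi_continuous: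
  assumes "0 < e" "\<theta> \<ge> 0" shows "continuous_on {e..t0} (Psi a \<nu> V \<theta>)"
proof -
  let ?M = "\<lambda>t. LINT r|R_dist. exp (t * r)"
  have "continuous_on {e..t0} ?M"
    by (rule continuous_on_subset[OF continuous_on_integral_exp[OF R_fin]]) (use assms in auto)
  moreover have "?M t \<noteq> 0" if "t \<in> {e..t0}" for t
    using integral_exp_pos[OF R_fin, of t] that assms by auto
  ultimately have "continuous_on {e..t0} (\<lambda>t. (1 - \<theta> / ?M t) / t)"
    using assms by (intro continuous_intros) auto
  thus ?thesis
    by (rule continuous_on_eq) (use assms Psi_finite[OF fin] in auto)
qed

end

end

section \<open>Feasible pairs and the optimal constant\<close>

text \<open>
  The least nonnegative upper bound of a family of reals; the value is \<open>\<infinity>\<close> on both sides if there is none.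
\<close>

lemma Inf_upper_bounds_eq:
  fixes f :: "real \<Rightarrow> real"
  assumes "A \<noteq> {}"
  shows "Inf (ereal ` {c. c \<ge> 0 \<and> (\<forall>t\<in>A. f t \<le> c)}) = max 0 (SUP t\<in>A. ereal (f t))"
    (is "Inf (ereal ` ?C) = max 0 ?S")
proof (rule antisym)
  show "max 0 ?S \<le> Inf (ereal ` ?C)"
    by (rule Inf_greatest) (auto intro!: SUP_least)
  show "Inf (ereal ` ?C) \<le> max 0 ?S"
  proof (cases "max 0 ?S = \<infinity>")
    case False
    have "0 \<le> max 0 ?S" by simp
    with False obtain c where c: "max 0 ?S = ereal c" by (cases "max 0 ?S") auto
    have "c \<ge> 0" using \<open>0 \<le> max 0 ?S\<close> c by simp
    moreover have "f t \<le> c" if "t \<in> A" for t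
    proof -
      have "ereal (f t) \<le> ?S" using that by (rule SUP_upper)
      also have "\<dots> \<le> ereal c" unfolding c[symmetric] by simp
      finally show ?thesis by simp
    qed
    ultimately have "ereal c \<in> ereal ` ?C" by auto
    thus ?thesis unfolding c by (rule Inf_lower)
  qed (simp only: ereal_less_eq(1))
qed

context centered_levy
begin

definition Psi_sup :: "real \<Rightarrow> ereal" where
  "Psi_sup \<theta> = (SUP t\<in>{0<..}. ereal (Psi a \<nu> V \<theta> t))"

context
  fixes M :: "'b measure" and X :: "'b \<Rightarrow> real"
  assumes X: "X \<in> borel_measurable M" and distr: "\<mu> = distr M borel X"
begin

lemma cgf_eq_law: "cgf M X t = cgf \<mu> (\<lambda>x. x) t"
  unfolding cgf_def mgf_def distr using X by (simp add: nn_integral_distr)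

lemma cgf_0: "cgf M X 0 = 0"
proof -
  have "mgf \<mu> (\<lambda>x. x) 0 = 1" unfolding mgf_def using emeasure_space_1 by simp
  thus ?thesis unfolding cgf_eq_law[of 0] by (simp add: cgf_def zero_ereal_def)
qed

text \<open>
  By the representation \<open>cgf_eq_mgf_R\<close> the moment generating functions of \<open>X\<close> and of \<open>R\<close> are finite at the
  same points.
\<close>

lemma mgf_R_cases:
  assumes t: "t > 0"
  obtains (infinite) "mgf R_dist (\<lambda>r. r) t = \<infinity>" "cgf M X t = \<infinity>"
    | (finite) m where "m > 0" "mgf R_dist (\<lambda>r. r) t = ennreal m" "cgf M X t = ereal (V * t\<^sup>2 / 2 * m)"
proof (cases "mgf R_dist (\<lambda>r. r) t = \<infinity>")
  case True
  have "ennreal (V * t\<^sup>2 / 2) * \<infinity> = \<infinity>" using t variance_pos by (simp add: ennreal_mult_top)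
  hence "cgf M X t = \<infinity>" unfolding cgf_eq_law cgf_eq_mgf_R[OF t] True by simp
  thus thesis using True infinite by blast
next
  case False
  hence fin: "mgf R_dist (\<lambda>r. r) t < \<infinity>" by (simp add: less_top)
  note fin = real_distribution_R integrable_R t this
  have m: "mgf R_dist (\<lambda>r. r) t = ennreal (LINT r|R_dist. exp (t * r))" "(LINT r|R_dist. exp (t * r)) > 0"
    using mgf_eq_integral[OF fin, of t] integral_exp_pos[OF fin, of t] t by auto
  have "cgf M X t = enn2ereal (ennreal (V * t\<^sup>2 / 2 * (LINT r|R_dist. exp (t * r))))"
    unfolding cgf_eq_law cgf_eq_mgf_R[OF t] m(1) using m(2) variance_pos t by (subst ennreal_mult) auto
  also have "\<dots> = ereal (V * t\<^sup>2 / 2 * (LINT r|R_dist. exp (t * r)))"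
    using m(2) variance_pos t by (intro enn2ereal_ennreal) auto
  finally show thesis using m finite by blast
qed

lemma mgf_R_finite:
  assumes "t > 0" "cgf M X t < \<infinity>" shows "mgf R_dist (\<lambda>r. r) t < \<infinity>"
  using assms(1) by (cases rule: mgf_R_cases) (use assms(2) in simp_all)

text \<open>
  With \<open>K(t) = (V t\<^sup>2 / 2) M\<^sub>R(t)\<close> the bound becomes \<open>M\<^sub>R(t) (1 - c t) \<le> \<theta>\<close>, which is linear in \<open>c\<close>. Where \<open>c t \<ge> 1\<close> there is
  no constraint, in accordance with \<open>\<Psi>\<^sub>\<theta>(t) \<le> 1/t \<le> c\<close>.
\<close>

lemma cgf_bound_iff_Psi_le:
  assumes t: "t > 0" and c: "c \<ge> 0" and v: "v > 0"
  shows "(c * t < 1 \<longrightarrow> cgf M X t \<le> ereal (v * t\<^sup>2 / (2 * (1 - c * t)))) \<longleftrightarrow> Psi a \<nu> V (v / V) t \<le> c"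
  using t
proof (cases rule: mgf_R_cases)
  case infinite
  thus ?thesis using t by (simp add: Psi_infinite not_less field_simps)
next
  case (finite m)
  note V = variance_pos
  have Psi: "Psi a \<nu> V (v / V) t = (1 - v / V / m) / t"
    unfolding Psi_def finite(2) using finite(1) v V by (simp add: divide_ennreal)
  show ?thesis
  proof (cases "c * t < 1")
    case True
    have "cgf M X t \<le> ereal (v * t\<^sup>2 / (2 * (1 - c * t))) \<longleftrightarrow> V * m * (1 - c * t) \<le> v"
    proof -
      define k where "k = t\<^sup>2 / (2 * (1 - c * t))"
      have k: "k > 0" using True t by (simp add: k_def)
      have "V * t\<^sup>2 / 2 * m = (V * m * (1 - c * t)) * k" "v * t\<^sup>2 / (2 * (1 - c * t)) = v * k"
        using True by (simp_all add: k_def field_simps)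
      thus ?thesis unfolding finite(3) ereal_less_eq(3) by (simp only: mult_le_cancel_right_pos[OF k])
    qed
    also have "\<dots> \<longleftrightarrow> Psi a \<nu> V (v / V) t \<le> c"
      unfolding Psi using V finite(1) t by (simp add: field_simps)
    finally show ?thesis using True by simp
  next
    case False
    have "(1 - v / V / m) / t \<le> 1 / t"
      using finite(1) v V t by (intro divide_right_mono) auto
    also have "\<dots> \<le> c" using False t by (simp add: field_simps)
    finally show ?thesis using False Psi by simp
  qed
qed

lemma feasible_iff:
  assumes v: "v > 0"
  shows "feasible M X v c \<longleftrightarrow> c \<ge> 0 \<and> (\<forall>t\<in>{0<..}. Psi a \<nu> V (v / V) t \<le> c)"
proof (cases "c \<ge> 0")
  case True
  have dom: "c = 0 \<or> t < 1 / c \<longleftrightarrow> c * t < 1" for t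
    using True by (cases "c = 0") (auto simp: field_simps)
  have zero: "cgf M X 0 \<le> ereal (v * 0\<^sup>2 / (2 * (1 - c * 0)))" by (simp add: cgf_0)
  have "feasible M X v c \<longleftrightarrow> (\<forall>t>0. c * t < 1 \<longrightarrow> cgf M X t \<le> ereal (v * t\<^sup>2 / (2 * (1 - c * t))))"
    unfolding feasible_def dom using True v zero by (metis order_le_less)
  also have "\<dots> \<longleftrightarrow> (\<forall>t>0. Psi a \<nu> V (v / V) t \<le> c)"
    using cgf_bound_iff_Psi_le[OF _ True v] by blast
  finally show ?thesis using True by auto
qed (simp add: feasible_def)

lemma c_star_eq:
  assumes "v > 0" shows "c_star M X v = max 0 (Psi_sup (v / V))"
proof -
  have "{0::real<..} \<noteq> {}" by auto
  from Inf_upper_bounds_eq[OF this, of "Psi a \<nu> V (v / V)"]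
  show ?thesis unfolding c_star_def Psi_sup_def feasible_iff[OF assms] .
qed

lemma mgf_R_below_tau:
  assumes "t > 0" "ereal t < tau M X"
  obtains t' where "t < t'" "mgf R_dist (\<lambda>r. r) t' < \<infinity>"
proof -
  obtain t' where t': "t < t'" "cgf M X t' < \<infinity>"
    using assms unfolding tau_def less_Sup_iff by auto
  have "mgf R_dist (\<lambda>r. r) t' < \<infinity>"
    using mgf_R_finite[OF _ t'(2)] t'(1) assms(1) by simp
  thus thesis using t' that by blast
qed

lemma Psi_above_tau:
  assumes "t > 0" "ereal t > tau M X"
  shows "Psi a \<nu> V \<theta> t = 1 / t"
proof -
  have "cgf M X t = \<infinity>"
  proof (rule ccontr)
    assume "cgf M X t \<noteq> \<infinity>"
    hence "ereal t \<le> tau M X" unfolding tau_def using assms(1) by (intro Sup_upper) auto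
    thus False using assms(2) by simp
  qed
  hence "mgf R_dist (\<lambda>r. r) t = \<infinity>" using mgf_R_cases[OF assms(1)] by (metis PInfty_neq_ereal(1))
  thus ?thesis by (rule Psi_infinite)
qed

lemma inverse_tau_le_Psi_sup:
  assumes \<tau>: "tau M X = ereal \<tau>" "\<tau> > 0"
  shows "ereal (1 / \<tau>) \<le> Psi_sup \<theta>"
proof -
  have "((\<lambda>t. ereal (1 / t)) \<longlongrightarrow> ereal (1 / \<tau>)) (at_right \<tau>)"
    using \<tau> by (intro tendsto_intros) auto
  moreover have "\<forall>\<^sub>F t in at_right \<tau>. ereal (1 / t) \<le> Psi_sup \<theta>"
    using eventually_at_right_less[of \<tau>]
  proof eventually_elim
    case (elim t)
    hence "ereal (1 / t) = ereal (Psi a \<nu> V \<theta> t)" using \<tau> Psi_above_tau[of t \<theta>] by simp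
    also have "\<dots> \<le> Psi_sup \<theta>" unfolding Psi_sup_def using elim \<tau> by (intro SUP_upper) auto
    finally show ?case .
  qed
  ultimately show ?thesis by (rule tendsto_upperbound) simp
qed

text \<open>
  Near the origin \<open>\<Psi>\<^sub>\<theta>\<close> is negative, and beyond \<open>1/c\<close> it is at most \<open>1/t < c\<close>. Values above \<open>c\<close> therefore occur only in a
  compact subinterval of \<open>(0, \<tau>)\<close>, on which \<open>\<Psi>\<^sub>\<theta>\<close> is continuous. Choosing \<open>1/c < \<tau>\<close> keeps this interval away from
  the endpoint \<open>\<tau>\<close>, where \<open>M\<^sub>R\<close> may be infinite.
\<close>

lemma Psi_sup_attained:
  assumes \<theta>: "\<theta> > 1" and c: "0 < c" "ereal (1 / c) < tau M X" "ereal c < Psi_sup \<theta>"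
  shows "\<exists>t>0. ereal (Psi a \<nu> V \<theta> t) = Psi_sup \<theta>"
proof -
  have T: "1 / c > 0" using c by simp
  obtain t0 where t0: "1 / c < t0" "mgf R_dist (\<lambda>r. r) t0 < \<infinity>"
    using mgf_R_below_tau[OF T c(2)] by blast
  have "t0 > 0" using T t0 by linarith
  note fin = this t0(2)
  have "\<forall>\<^sub>F t in at_right 0. Psi a \<nu> V \<theta> t \<le> 0"
    using Psi_at_bot[OF fin \<theta>] by (auto simp: filterlim_at_bot)
  then obtain e where e: "e > 0" "\<And>t. 0 < t \<Longrightarrow> t < e \<Longrightarrow> Psi a \<nu> V \<theta> t \<le> 0"
    unfolding eventually_at_right_field by auto
  have out: "e \<le> t \<and> t \<le> 1 / c" if "t > 0" "Psi a \<nu> V \<theta> t > c" for t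
  proof (rule ccontr)
    assume "\<not> (e \<le> t \<and> t \<le> 1 / c)"
    hence "t < e \<or> 1 / t < c" using that c by (auto simp: field_simps)
    thus False using e(2)[of t] Psi_le[of t \<theta>] that c \<theta> by auto
  qed
  from c(3) obtain t1 where t1: "t1 > 0" "Psi a \<nu> V \<theta> t1 > c"
    unfolding Psi_sup_def less_SUP_iff by auto
  have "continuous_on {e..1 / c} (Psi a \<nu> V \<theta>)"
    by (rule continuous_on_subset[OF Psi_continuous[OF fin e(1), of \<theta>]]) (use t0 \<theta> in auto)
  moreover have "{e..1 / c} \<noteq> {}" using out[OF t1] by auto
  ultimately obtain s where s: "s \<in> {e..1 / c}" "\<And>t. t \<in> {e..1 / c} \<Longrightarrow> Psi a \<nu> V \<theta> t \<le> Psi a \<nu> V \<theta> s"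
    using continuous_attains_sup[of "{e..1 / c}" "Psi a \<nu> V \<theta>"] by auto
  have "Psi a \<nu> V \<theta> t \<le> Psi a \<nu> V \<theta> s" if "t > 0" for t
    using out[OF that] s(2)[of t] s(2)[of t1] out[OF t1] t1 by fastforce
  hence "Psi_sup \<theta> = ereal (Psi a \<nu> V \<theta> s)"
    unfolding Psi_sup_def using s(1) e(1) by (intro SUP_eqI) auto
  moreover have "s > 0" using s(1) e(1) by auto
  ultimately show ?thesis by auto
qed

text \<open>
  Since \<open>\<Psi>\<^sub>\<theta>(t) = 1/t\<close> beyond \<open>\<tau>\<close>, the supremum is at least \<open>1/\<tau>\<close>. If it is larger, a real number between
  \<open>1/\<tau>\<close> and the supremum serves as the level \<open>c\<close> of \<open>Psi_sup_attained\<close>.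
\<close>

lemma Psi_sup_trichotomy:
  assumes v: "v > V" and \<tau>: "tau M X > 0"
  defines "\<theta> \<equiv> v / V"
  shows "(\<exists>t>0. ereal (Psi a \<nu> V \<theta> t) = Psi_sup \<theta>)
    \<or> (tau M X < \<infinity> \<and> c_star M X v = Psi_sup \<theta> \<and> Psi_sup \<theta> = 1 / tau M X)
    \<or> Psi_sup \<theta> \<le> 0"
proof -
  have \<theta>: "\<theta> > 1" using v variance_pos by (simp add: \<theta>_def)
  have attained: "\<exists>t>0. ereal (Psi a \<nu> V \<theta> t) = Psi_sup \<theta>"
    if q: "q \<ge> 0" "ereal q < Psi_sup \<theta>" "\<And>c. c > q \<Longrightarrow> ereal (1 / c) < tau M X" for q
  proof -
    obtain c where "ereal q < ereal c" "ereal c < Psi_sup \<theta>" using ereal_dense2[OF q(2)] by blast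
    thus ?thesis using Psi_sup_attained[OF \<theta>, of c] q by auto
  qed
  show ?thesis
  proof (cases "tau M X")
    case (real \<tau>')
    hence \<tau>': "\<tau>' > 0" using \<tau> by simp
    have eq: "1 / tau M X = ereal (1 / \<tau>')" using real \<tau>' by (simp add: one_ereal_def)
    show ?thesis
    proof (cases "Psi_sup \<theta> = ereal (1 / \<tau>')")
      case True
      moreover have "c_star M X v = Psi_sup \<theta>"
        unfolding c_star_eq[OF order.strict_trans[OF variance_pos v]] \<theta>_def[symmetric] True using \<tau>' by (simp add: max_def)
      ultimately show ?thesis using real eq by simp
    next
      case False
      hence "ereal (1 / \<tau>') < Psi_sup \<theta>" using inverse_tau_le_Psi_sup[OF real \<tau>'] by (simp add: order_less_le)
      moreover have "ereal (1 / c) < tau M X" if "c > 1 / \<tau>'" for c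
      proof -
        have "0 < 1 / \<tau>'" using \<tau>' by simp
        hence "c > 0" using that by linarith
        thus ?thesis using that \<tau>' unfolding real by (simp add: field_simps)
      qed
      ultimately show ?thesis using attained[of "1 / \<tau>'"] \<tau>' by auto
    qed
  next
    case PInf
    thus ?thesis using attained[of 0] by (cases "Psi_sup \<theta> \<le> 0") (auto simp: zero_ereal_def[symmetric] not_le)
  qed (use \<tau> in auto)
qed

lemma c_star_variance_ge:
  assumes \<tau>: "tau M X > 0"
  shows "c_star M X V \<ge> ereal (max 0 (cumulant 3 \<mu> / (3 * V)))"
proof -
  obtain t where "t > 0" "cgf M X t < \<infinity>" using \<tau> unfolding tau_def less_Sup_iff by auto
  hence fin: "t > 0" "mgf R_dist (\<lambda>r. r) t < \<infinity>" using mgf_R_finite by blast+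
  have "((\<lambda>t. ereal (Psi a \<nu> V 1 t)) \<longlongrightarrow> ereal (LINT r|R_dist. r)) (at_right 0)"
    by (intro tendsto_ereal Psi_1_tendsto[OF fin])
  moreover have "\<forall>\<^sub>F t in at_right 0. ereal (Psi a \<nu> V 1 t) \<le> Psi_sup 1"
    using eventually_at_right_less[of 0] by eventually_elim (auto simp: Psi_sup_def intro!: SUP_upper)
  ultimately have "ereal (LINT r|R_dist. r) \<le> Psi_sup 1"
    by (rule tendsto_upperbound) simp
  hence "max 0 (ereal (cumulant 3 \<mu> / (3 * V))) \<le> max 0 (Psi_sup 1)"
    unfolding integral_R by (intro max.mono order_refl)
  moreover have "max 0 (ereal x) = ereal (max 0 x)" for x
    by (simp add: max_def zero_ereal_def)
  ultimately show ?thesis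
    using c_star_eq[OF variance_pos] variance_pos by simp
qed

end

end

theorem proposition4p4:
  fixes M :: "'a measure" and X :: "'a \<Rightarrow> real" and a V :: real and \<nu> :: "real measure"
  assumes "prob_space M"
    and "X \<in> borel_measurable M"
    and "integrable M (\<lambda>\<omega>. (X \<omega>)\<^sup>2)"
    and "prob_space.expectation M X = 0"
    and "V = prob_space.variance M X"
    and "V > 0"
    and "infinitely_divisible (distr M borel X)"
    and "has_levy_characteristics (distr M borel X) a \<nu>"
    and "(\<integral>\<^sup>+x\<in>{x. \<bar>x\<bar> > 1}. ennreal (\<bar>x\<bar> ^ 3) \<partial>\<nu>) < \<infinity>"
    and "tau M X > 0"
  shows "let \<kappa>\<^sub>3 = cumulant 3 (distr M borel X);
             m\<^sub>1 = (LINT r|R_law a \<nu> V. r);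
             \<Psi> = Psi a \<nu> V
         in integrable (R_law a \<nu> V) (\<lambda>r. r) \<and> m\<^sub>1 = \<kappa>\<^sub>3 / (3 * V)
          \<and> (\<Psi> 1 \<longlongrightarrow> m\<^sub>1) (at_right 0)
          \<and> (\<forall>\<theta>>1. filterlim (\<Psi> \<theta>) at_bot (at_right 0))
          \<and> c_star M X V \<ge> ereal (max 0 (\<kappa>\<^sub>3 / (3 * V)))
          \<and> (\<forall>v>V. let \<theta> = v / V; S = (SUP t\<in>{0<..}. ereal (\<Psi> \<theta> t)) in
                ((\<exists>t>0. ereal (\<Psi> \<theta> t) = S)
                 \<or> (tau M X < \<infinity> \<and> c_star M X v = S \<and> S = 1 / tau M X)
                 \<or> S \<le> 0)
                \<and> (S \<le> 0 \<longrightarrow> c_star M X v = 0))"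
proof -
  interpret M: prob_space M by fact
  let ?\<mu> = "distr M borel X"
  interpret L: centered_levy ?\<mu> a V \<nu>
  proof (intro centered_levy.intro centered_levy_axioms.intro)
    show "real_distribution ?\<mu>" using assms(2) by (rule M.real_distribution_distr)
    show "integrable ?\<mu> (\<lambda>x. x\<^sup>2)" using assms(2,3) by (subst integrable_distr_eq) auto
    show "(LINT x|?\<mu>. x) = 0" using assms(2,4) by (subst integral_distr) auto
    show "V = (LINT x|?\<mu>. x\<^sup>2)" using assms(2,4,5) by (subst integral_distr) auto
  qed (use assms in auto)
  note law = assms(2) refl[of ?\<mu>]
  obtain t where "t > 0" "cgf M X t < \<infinity>" using assms(10) unfolding tau_def less_Sup_iff by auto
  hence fin: "t > 0" "mgf (R_law a \<nu> V) (\<lambda>r. r) t < \<infinity>"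
    using L.mgf_R_finite[OF law] by blast+
  have "c_star M X v = 0" if "v > V" "L.Psi_sup (v / V) \<le> 0" for v
    using L.c_star_eq[OF law, of v] that assms(6) by (simp add: max_absorb1)
  thus ?thesis
    unfolding Let_def L.Psi_sup_def[symmetric]
    using L.integrable_R L.integral_R L.Psi_1_tendsto[OF fin] L.Psi_at_bot[OF fin]
      L.c_star_variance_ge[OF law assms(10)] L.Psi_sup_trichotomy[OF law _ assms(10)]
    by blast
qed

end
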